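(* Let $G=(V,E)$ be a finite connected simple graph with treewidth $\operatorname{tw}(G)\le 3$. Then $x\mapsto T_G(x)^{-\beta}$ is completely monotone on $(0,\infty)^E$ for every real $\beta>1$. Hence every finite connected partial $3$-tree belongs to $\mathcal{G}_\beta$ for every $\beta$ with $1<\beta<3/2$.
   Context: For a finite connected graph $G=(V,E)$, the spanning-tree polynomial is $T_G(x)=\sum_{T\in\mathcal{T}(G)}\prod_{e\in T}x_e$, $x=(x_e)_{e\in E}$, where $\mathcal{T}(G)$ is the set of spanning trees of $G$. A function $f\in C^\infty((0,\infty)^n)$ is completely monotone if $(-1)^{|\alpha|}\partial^\alpha f(x)\ge 0$ for all multi-indices $\alpha\in\mathbb{N}^n$ and all $x\in(0,\infty)^n$. For $\beta>0$, $\mathcal{G}_\beta$ denotes the class of finite connected graphs $G$ such that $T_G^{-\beta}$ is completely monotone on $(0,\infty)^E$. Treewidth is the standard graph parameter; equivalently, $\operatorname{tw}(G)\le k$ iff $G$ is a spanning subgraph of a chordal graph on the same vertex set with clique number at most $k+1$. A partial $3$-tree is a graph of treewidth at most $3$. *)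

theory Defs
  imports "HOL-Analysis.Analysis"
begin

section \<open>Finite simple graphs and spanning trees\<close>

text \<open>
  A graph is given by a vertex set V and a set E of edges, each edge being a
  two-element subset of V.  The notions of AFP Graph\_Theory are not used:
  its trees and forests exclude directed closed walks, so a symmetric digraph with at
  least one edge is never a forest there.
\<close>

definition simple_graph :: "'v set \<Rightarrow> 'v set set \<Rightarrow> bool" where
  "simple_graph V E \<longleftrightarrow> finite V \<and> (\<forall>e\<in>E. e \<subseteq> V \<and> card e = 2)"

definition connected_graph :: "'v set \<Rightarrow> 'v set set \<Rightarrow> bool" where
  "connected_graph V E \<longleftrightarrow>
     V \<noteq> {} \<and> (\<forall>u\<in>V. \<forall>v\<in>V. (u, v) \<in> {(a, b). {a, b} \<in> E}\<^sup>*)"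

definition graph_cycle :: "'v set set \<Rightarrow> 'v list \<Rightarrow> bool" where
  "graph_cycle E p \<longleftrightarrow> 3 \<le> length p \<and> distinct p \<and>
     (\<forall>i<length p. {p ! i, p ! (Suc i mod length p)} \<in> E)"

definition tree_graph :: "'v set \<Rightarrow> 'v set set \<Rightarrow> bool" where
  "tree_graph V E \<longleftrightarrow>
     simple_graph V E \<and> connected_graph V E \<and> (\<nexists>p. graph_cycle E p)"

definition spanning_trees :: "'v set \<Rightarrow> 'v set set \<Rightarrow> 'v set set set" where
  "spanning_trees V E = {T. T \<subseteq> E \<and> tree_graph V T}"

definition spanning_tree_poly :: "'v set \<Rightarrow> 'v set set \<Rightarrow> ('v set \<Rightarrow> real) \<Rightarrow> real" where
  "spanning_tree_poly V E x = (\<Sum>T\<in>spanning_trees V E. \<Prod>e\<in>T. x e)"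


section \<open>Treewidth\<close>

text \<open>
  The decomposition tree has nodes in the natural numbers, which is no restriction since
  it is finite.
\<close>

definition tree_decomposition ::
    "'v set \<Rightarrow> 'v set set \<Rightarrow> nat set \<Rightarrow> nat set set \<Rightarrow> (nat \<Rightarrow> 'v set) \<Rightarrow> bool" where
  "tree_decomposition V E I F B \<longleftrightarrow>
     tree_graph I F \<and>
     (\<Union>i\<in>I. B i) = V \<and>
     (\<forall>e\<in>E. \<exists>i\<in>I. e \<subseteq> B i) \<and>
     (\<forall>v\<in>V. connected_graph {i\<in>I. v \<in> B i} {f\<in>F. f \<subseteq> {i\<in>I. v \<in> B i}})"

definition decomposition_width :: "nat set \<Rightarrow> (nat \<Rightarrow> 'v set) \<Rightarrow> nat" where
  "decomposition_width I B = Max ((\<lambda>i. card (B i)) ` I) - 1"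

text \<open>
  For nonempty V some bag is nonempty, so the subtraction in the width does not truncate;
  the one-bag decomposition shows that the minimum is over a nonempty set.
\<close>

definition treewidth :: "'v set \<Rightarrow> 'v set set \<Rightarrow> nat" where
  "treewidth V E =
     (LEAST w. \<exists>I F B. tree_decomposition V E I F B \<and> w = decomposition_width I B)"

definition partial_k_tree :: "nat \<Rightarrow> 'v set \<Rightarrow> 'v set set \<Rightarrow> bool" where
  "partial_k_tree k V E \<longleftrightarrow> simple_graph V E \<and> treewidth V E \<le> k"


section \<open>Complete monotonicity\<close>

text \<open>
  The orthant \<open>(0,\<infinity>)\<^sup>E\<close> is rendered as a set of extensional functions; with the product
  topology of the function type it carries the usual topology of a finite-dimensional
  orthant when E is finite.
\<close>

definition pos_orthant :: "'e set \<Rightarrow> ('e \<Rightarrow> real) set" where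
  "pos_orthant E = (\<Pi>\<^sub>E e\<in>E. {0<..})"

definition partial_deriv :: "'e \<Rightarrow> (('e \<Rightarrow> real) \<Rightarrow> real) \<Rightarrow> ('e \<Rightarrow> real) \<Rightarrow> real" where
  "partial_deriv e f x = deriv (\<lambda>t. f (x(e := t))) (x e)"

primrec partial_derivs :: "'e list \<Rightarrow> (('e \<Rightarrow> real) \<Rightarrow> real) \<Rightarrow> ('e \<Rightarrow> real) \<Rightarrow> real" where
  "partial_derivs [] f = f"
| "partial_derivs (e # es) f = partial_deriv e (partial_derivs es f)"

text \<open>Membership in \<open>C\<^sup>\<infinity>\<close>: all iterated partial derivatives exist and are continuous.\<close>

definition smooth_on_orthant :: "'e set \<Rightarrow> (('e \<Rightarrow> real) \<Rightarrow> real) \<Rightarrow> bool" where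
  "smooth_on_orthant E f \<longleftrightarrow>
     (\<forall>es\<in>lists E. continuous_on (pos_orthant E) (partial_derivs es f) \<and>
        (\<forall>e\<in>E. \<forall>x\<in>pos_orthant E.
           (\<lambda>t. partial_derivs es f (x(e := t))) differentiable (at (x e))))"

text \<open>
  A list es over E stands for the multi-index \<open>\<alpha>\<close> whose entry at e is the number of
  occurrences of e in es, so \<open>|\<alpha>|\<close> is the length of es.  The order of differentiation
  is immaterial for smooth functions.
\<close>

definition completely_monotone :: "'e set \<Rightarrow> (('e \<Rightarrow> real) \<Rightarrow> real) \<Rightarrow> bool" where
  "completely_monotone E f \<longleftrightarrow> smooth_on_orthant E f \<and>
     (\<forall>es\<in>lists E. \<forall>x\<in>pos_orthant E. 0 \<le> (-1) ^ length es * partial_derivs es f x)"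

definition cm_graph_class :: "real \<Rightarrow> ('v set \<times> 'v set set) set" where
  "cm_graph_class \<beta> = {(V, E). simple_graph V E \<and> connected_graph V E \<and>
     completely_monotone E (\<lambda>x. spanning_tree_poly V E x powr (- \<beta>))}"

end

theory Submission
  imports Defs "HOL-Probability.Probability"
begin

text \<open>
  A graph of treewidth at most 3 is a spanning subgraph of a graph \<open>H\<close> built from one vertex by
  repeatedly joining a new vertex \<open>n\<close> to a clique of at most three vertices.  The
  star-mesh transformation eliminates \<open>n\<close> again: if its edges to \<open>a, b, c\<close> have weights
  \<open>x, y, z\<close> with sum \<open>s\<close>, then \<open>T = s T'\<close>, where \<open>T'\<close> is the polynomial of the smaller graph
  with \<open>xy/s\<close> added to the weight of \<open>ab\<close>, and so on.  Inductively, \<open>T\<^sup>-\<^sup>\<beta>\<close> is the Laplace transform of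
  a measure on squared edge lengths for which every triangle of \<open>H\<close> is Euclidean.  Realising the
  triangle \<open>abc\<close> in the plane, \<open>s\<^sup>-\<^sup>\<beta> exp (- (xy|ab|\<^sup>2 + yz|bc|\<^sup>2 + xz|ac|\<^sup>2) / s)\<close> is,
  up to a constant, a Gaussian integral over the position of \<open>n\<close> in Euclidean space of
  ``dimension \<open>2\<beta>\<close>'', that is, over a point of the plane and a height above it with
  squared height distributed as \<open>\<rho>\<^sup>\<beta>\<^sup>-\<^sup>2 d\<rho>\<close>; this is where \<open>\<beta> > 1\<close> enters.
  The new triangles are again Euclidean.  Edges missing in \<open>G\<close> get weight 0.
\<close>

section \<open>Connectivity and spanning trees\<close>

text \<open>The representing measure must not depend on the weights. The Gaussian integral delivers
  this: its exponent pairs the weights with the squared distances from \<open>n\<close> to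
  \<open>a, b, c\<close>, so integrating out the position of \<open>n\<close> turns the Laplace
  integrand of the larger graph at weights \<open>w\<close> into that of the smaller graph at the
  meshed weights. The obstacle is that the mesh exponent arises in this way only if the three
  squared lengths come from actual points. Nonnegativity is not enough, so the triangle condition
  has to travel through the induction, and the placement of the triangle has to depend measurably on
  the lengths. Three points span at most a plane, and the other 2\<beta> - 2 dimensions are seen
  only through the squared height, whose density is integrable at 0 exactly when \<beta> > 1. A
  clique of four would take up three dimensions and lead in the same way to \<beta> > 3/2; below 3/2
  this argument therefore stops at treewidth 3.\<close>

definition reachable :: "'v set set \<Rightarrow> 'v \<Rightarrow> 'v \<Rightarrow> bool" where
  "reachable A p q \<longleftrightarrow> (p, q) \<in> {(a, b). {a, b} \<in> A}\<^sup>*"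

text \<open>Acyclicity in the form that every edge is a bridge. This form is stable under adding one
  edge at a time, and it is also what is used about the decomposition tree. A singleton
  \<open>{u, u}\<close> in \<open>A\<close> makes it false.\<close>

definition forest :: "'v set set \<Rightarrow> bool" where
  "forest A \<longleftrightarrow> (\<forall>u v. {u, v} \<in> A \<longrightarrow> \<not> reachable (A - {{u, v}}) u v)"

text \<open>No transitive closure is needed: over an equivalence relation, one passage through the
  identified pair, in either direction, suffices.\<close>

definition merge_classes :: "('v \<Rightarrow> 'v \<Rightarrow> bool) \<Rightarrow> 'v \<Rightarrow> 'v \<Rightarrow> 'v \<Rightarrow> 'v \<Rightarrow> bool" where
  "merge_classes r u v p q \<longleftrightarrow> r p q \<or> r p u \<and> r v q \<or> r p v \<and> r u q"

lemma reachable_refl [simp]: "reachable A p p"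
  by (simp add: reachable_def)

lemma reachable_edge: "{p, q} \<in> A \<Longrightarrow> reachable A p q"
  by (auto simp: reachable_def)

lemma reachable_trans: "reachable A p q \<Longrightarrow> reachable A q s \<Longrightarrow> reachable A p s"
  unfolding reachable_def by (rule rtrancl_trans)

lemma reachable_sym: "reachable A p q \<Longrightarrow> reachable A q p"
proof -
  have "sym {(a, b). {a, b} \<in> A}"
    by (auto simp: sym_def insert_commute)
  then show "reachable A p q \<Longrightarrow> reachable A q p"
    unfolding reachable_def by (metis sym_rtrancl symD)
qed

lemma reachable_mono: "A \<subseteq> B \<Longrightarrow> reachable A p q \<Longrightarrow> reachable B p q"
  unfolding reachable_def by (rule subsetD[OF rtrancl_mono]) auto

lemma reachable_induct [consumes 1, case_names refl step]:
  assumes "reachable A p q" "P p" "\<And>x y. reachable A p x \<Longrightarrow> {x, y} \<in> A \<Longrightarrow> P x \<Longrightarrow> P y"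
  shows "P q"
  using assms(1) unfolding reachable_def
  by (induction rule: rtrancl_induct) (use assms in \<open>auto simp: reachable_def\<close>)

lemma equivp_reachable: "equivp (reachable A)"
  by (rule equivpI) (auto simp: reflp_def symp_def transp_def intro: reachable_sym reachable_trans)

lemma equivp_merge:
  assumes "equivp r"
  shows "equivp (merge_classes r u v)"
proof (rule equivpI)
  show "reflp (merge_classes r u v)"
    using assms by (auto simp: reflp_def merge_classes_def intro: equivp_reflp)
  show "symp (merge_classes r u v)"
    using assms by (auto simp: symp_def merge_classes_def dest: equivp_symp)
  \<comment> \<open>An equivalence is equality of classes, which turns the case analysis into
    equational reasoning.\<close>
  have eq: "r x y \<longleftrightarrow> r x = r y" for x y
    using assms by (rule equivp_def[THEN iffD1, rule_format])
  show "transp (merge_classes r u v)"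
  proof (rule transpI)
    fix x y z assume "merge_classes r u v x y" "merge_classes r u v y z"
    with eq show "merge_classes r u v x z"
      unfolding merge_classes_def by metis
  qed
qed

lemma merge_commute: "merge_classes r u v = merge_classes r v u"
  by (auto simp: merge_classes_def fun_eq_iff)

text \<open>From left to right, the merged relation is an equivalence containing every edge, old or
  new, so each step of a walk stays in it.\<close>

lemma reachable_insert: "reachable (insert {u, v} A) = merge_classes (reachable A) u v"
proof (intro ext iffI)
  fix p q
  assume "reachable (insert {u, v} A) p q"
  then show "merge_classes (reachable A) u v p q"
  proof (induction rule: reachable_induct)
    case refl
    then show ?case by (simp add: merge_classes_def)
  next
    case (step x y)
    have "merge_classes (reachable A) u v x y"
      using step(2) by (auto simp: merge_classes_def doubleton_eq_iff intro: reachable_edge)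
    with step show ?case
      using equivp_transp[OF equivp_merge[OF equivp_reachable]] by metis
  qed
next
  fix p q
  assume "merge_classes (reachable A) u v p q"
  moreover have "reachable A x y \<Longrightarrow> reachable (insert {u, v} A) x y" for x y
    by (rule reachable_mono[of A]) auto
  moreover have "reachable (insert {u, v} A) u v" by (rule reachable_edge) simp
  ultimately show "reachable (insert {u, v} A) p q"
    unfolding merge_classes_def by (meson reachable_sym reachable_trans)
qed

lemma forest_empty [simp]: "forest {}"
  by (simp add: forest_def)

lemma forest_insert:
  assumes "{u, v} \<notin> A"
  shows "forest (insert {u, v} A) \<longleftrightarrow> forest A \<and> \<not> reachable A u v"
proof
  assume *: "forest (insert {u, v} A)"
  have "\<not> reachable A u v"
    using * assms unfolding forest_def by auto
  moreover have "forest A"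
    unfolding forest_def
  proof (intro allI impI notI)
    fix p q assume "{p, q} \<in> A" "reachable (A - {{p, q}}) p q"
    moreover from this(2) have "reachable (insert {u, v} A - {{p, q}}) p q"
      by (rule reachable_mono[rotated]) auto
    ultimately show False
      using * unfolding forest_def by auto
  qed
  ultimately show "forest A \<and> \<not> reachable A u v" by simp
next
  assume *: "forest A \<and> \<not> reachable A u v"
  show "forest (insert {u, v} A)"
    unfolding forest_def
  proof (intro allI impI notI)
    fix p q assume pq: "{p, q} \<in> insert {u, v} A" "reachable (insert {u, v} A - {{p, q}}) p q"
    show False
    proof (cases "{p, q} = {u, v}")
      case True
      then have "reachable A p q"
        using pq assms by auto
      then show False
        using * True reachable_sym by (metis doubleton_eq_iff)
    next
      case False
      then have A: "{p, q} \<in> A" using pq by auto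
      have "insert {u, v} A - {{p, q}} = insert {u, v} (A - {{p, q}})"
        using False by auto
      then have "merge_classes (reachable (A - {{p, q}})) u v p q"
        using pq by (simp add: reachable_insert)
      moreover have "\<not> reachable (A - {{p, q}}) p q"
        using * A unfolding forest_def by blast
      \<comment> \<open>A connection from \<open>p\<close> to \<open>q\<close> avoiding their own
        edge has to cross the new edge; closing it up through \<open>{p, q}\<close> joins
        \<open>u\<close> to \<open>v\<close> inside \<open>A\<close>.\<close>
      ultimately have "reachable (A - {{p, q}}) p u \<and> reachable (A - {{p, q}}) v q \<or>
          reachable (A - {{p, q}}) p v \<and> reachable (A - {{p, q}}) u q"
        by (auto simp: merge_classes_def)
      moreover have "reachable (A - {{p, q}}) x y \<Longrightarrow> reachable A x y" for x y
        by (rule reachable_mono[of "A - {{p, q}}"]) auto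
      ultimately have "reachable A u v"
        using reachable_edge[OF A] by (meson reachable_sym reachable_trans)
      then show False using * by simp
    qed
  qed
qed

section \<open>Bridges, simple paths and cycles\<close>

lemma reachable_imp_path:
  assumes "reachable A u v"
  shows "\<exists>p. p \<noteq> [] \<and> hd p = u \<and> last p = v \<and> distinct p \<and>
           (\<forall>i. Suc i < length p \<longrightarrow> {p ! i, p ! Suc i} \<in> A)"
  using assms
proof (induction rule: reachable_induct)
  case refl
  then show ?case by (intro exI[of _ "[u]"]) auto
next
  case (step x y)
  then obtain p where p: "p \<noteq> []" "hd p = u" "last p = x" "distinct p"
    "\<And>i. Suc i < length p \<Longrightarrow> {p ! i, p ! Suc i} \<in> A" by blast
  show ?case
  proof (cases "y \<in> set p")
    case True
    \<comment> \<open>The path already visits \<open>y\<close>, so it is cut off there instead of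
      being extended.\<close>
    then obtain i where i: "i < length p" "p ! i = y"
      by (auto simp: in_set_conv_nth)
    then have "last (take (Suc i) p) = y"
      by (simp add: take_Suc_conv_app_nth)
    then show ?thesis
      using p i by (intro exI[of _ "take (Suc i) p"]) auto
  next
    case False
    have "{(p @ [y]) ! i, (p @ [y]) ! Suc i} \<in> A" if "Suc i < length (p @ [y])" for i
    proof (cases "Suc i < length p")
      case True
      then show ?thesis using p(5)[of i] by (simp add: nth_append)
    next
      case False
      then have "i = length p - 1" "i < length p" "Suc i = length p"
        using that p(1) by (auto simp: le_Suc_eq)
      then show ?thesis
        using p(1,3) step(2) by (simp add: nth_append last_conv_nth)
    qed
    then show ?thesis
      using p False by (intro exI[of _ "p @ [y]"]) auto
  qed
qed

text \<open>The edge \<open>{u, v}\<close> closes a simple path to a cycle. The length is at least 3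
  because a path on two vertices would be the removed edge itself.\<close>

lemma graph_cycle_if_reachable:
  assumes "{u, v} \<in> T" "u \<noteq> v" "reachable (T - {{u, v}}) u v"
  shows "\<exists>p. graph_cycle T p"
proof -
  obtain p where p: "p \<noteq> []" "hd p = u" "last p = v" "distinct p"
    and e: "\<And>i. Suc i < length p \<Longrightarrow> {p ! i, p ! Suc i} \<in> T - {{u, v}}"
    using reachable_imp_path[OF assms(3)] by blast
  have u: "p ! 0 = u" and v: "p ! (length p - 1) = v"
    using p by (auto simp: hd_conv_nth last_conv_nth)
  have "length p \<noteq> 1" using u v assms(2) by auto
  moreover have "length p \<noteq> 2" using u v e[of 0] by auto
  moreover have "length p \<noteq> 0" using p by auto
  ultimately have 3: "3 \<le> length p" by linarith
  have "{p ! i, p ! (Suc i mod length p)} \<in> T" if "i < length p" for i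
  proof (cases "Suc i < length p")
    case True
    then show ?thesis using e[of i] by simp
  next
    case False
    then have "i = length p - 1" "Suc i = length p" using that by auto
    then show ?thesis using u v assms(1) by (simp add: insert_commute)
  qed
  then show ?thesis using 3 p(4) unfolding graph_cycle_def by blast
qed

lemma reachable_if_graph_cycle:
  assumes "graph_cycle T p"
  shows "\<exists>u v. {u, v} \<in> T \<and> reachable (T - {{u, v}}) u v"
proof -
  define n where "n = length p"
  have n: "3 \<le> n" "distinct p" and e: "\<And>i. i < n \<Longrightarrow> {p ! i, p ! (Suc i mod n)} \<in> T"
    using assms by (auto simp: graph_cycle_def n_def)
  let ?e = "{p ! 0, p ! (n - 1)}"
  have inT: "?e \<in> T"
    using e[of "n - 1"] n by (simp add: insert_commute)
  have "i < n \<Longrightarrow> reachable (T - {?e}) (p ! 0) (p ! i)" for i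
  proof (induction i)
    case 0
    then show ?case by simp
  next
    case (Suc i)
    \<comment> \<open>With at least three distinct vertices, the closing edge does not recur among
      the consecutive pairs.\<close>
    have "{p ! i, p ! Suc i} \<noteq> ?e"
    proof
      assume "{p ! i, p ! Suc i} = ?e"
      then have "p ! Suc i = p ! 0 \<or> p ! i = p ! 0 \<and> p ! Suc i = p ! (n - 1)"
        by (auto simp: doubleton_eq_iff)
      then have "Suc i = 0 \<or> i = 0 \<and> Suc i = n - 1"
        using n Suc.prems nth_eq_iff_index_eq[OF n(2), of "Suc i" 0] nth_eq_iff_index_eq[OF n(2), of i 0]
          nth_eq_iff_index_eq[OF n(2), of "Suc i" "n - 1"] unfolding n_def by linarith
      then show False using n by auto
    qed
    then have "{p ! i, p ! Suc i} \<in> T - {?e}"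
      using e[of i] Suc.prems by simp
    moreover have "reachable (T - {?e}) (p ! 0) (p ! i)"
      using Suc by simp
    ultimately show ?case
      using reachable_trans[OF _ reachable_edge] by fast
  qed
  from this[of "n - 1"] inT n show ?thesis by force
qed

text \<open>Links the bridge formulation to the cycles in \<open>tree_graph\<close>. Cardinality 2
  excludes singletons, which falsify \<open>forest\<close> but lie on no cycle.\<close>

lemma forest_iff_no_cycle:
  assumes "\<forall>e\<in>T. card e = 2"
  shows "forest T \<longleftrightarrow> (\<nexists>p. graph_cycle T p)"
proof
  show "\<nexists>p. graph_cycle T p" if "forest T"
  proof
    assume "\<exists>p. graph_cycle T p"
    then obtain p where "graph_cycle T p" ..
    from reachable_if_graph_cycle[OF this] that show False
      unfolding forest_def by auto
  qed
  show "forest T" if nocyc: "\<nexists>p. graph_cycle T p"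
    unfolding forest_def
  proof (intro allI impI notI)
    fix u v assume uv: "{u, v} \<in> T" "reachable (T - {{u, v}}) u v"
    then have "u \<noteq> v" using assms by force
    from graph_cycle_if_reachable[OF uv(1) this uv(2)] nocyc show False by simp
  qed
qed

lemma spanning_trees_eq:
  assumes "simple_graph V E" "V \<noteq> {}"
  shows "spanning_trees V E = {T. T \<subseteq> E \<and> forest T \<and> (\<forall>p\<in>V. \<forall>q\<in>V. reachable T p q)}"
proof -
  have "tree_graph V T \<longleftrightarrow> forest T \<and> (\<forall>p\<in>V. \<forall>q\<in>V. reachable T p q)" if "T \<subseteq> E" for T
  proof -
    have "simple_graph V T" "\<forall>e\<in>T. card e = 2"
      using assms(1) that by (auto simp: simple_graph_def)
    then show ?thesis
      using forest_iff_no_cycle assms(2)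
      by (auto simp: tree_graph_def connected_graph_def reachable_def)
  qed
  then show ?thesis by (auto simp: spanning_trees_def)
qed

lemma simple_graph_finite_edges: "simple_graph V E \<Longrightarrow> finite E"
  by (metis Pow_iff finite_Pow_iff finite_subset simple_graph_def subsetI)

text \<open>A connecting edge set of least cardinality is a forest: an edge that is not a bridge
  could be dropped without changing reachability.\<close>

lemma spanning_trees_nonempty:
  assumes "simple_graph V E" "connected_graph V E"
  shows "spanning_trees V E \<noteq> {}"
proof -
  let ?C = "\<lambda>T. T \<subseteq> E \<and> (\<forall>p\<in>V. \<forall>q\<in>V. reachable T p q)"
  have "?C E" using assms(2) by (auto simp: connected_graph_def reachable_def)
  then obtain T where T: "?C T" and min: "\<And>S. ?C S \<Longrightarrow> card T \<le> card S"
    using ex_has_least_nat[of ?C E card] by blast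
  have fin: "finite T"
    using T simple_graph_finite_edges[OF assms(1)] finite_subset by blast
  have "forest T"
    unfolding forest_def
  proof (intro allI impI notI)
    fix u v assume uv: "{u, v} \<in> T" "reachable (T - {{u, v}}) u v"
    have "merge_classes (reachable (T - {{u, v}})) u v = reachable (T - {{u, v}})"
      unfolding merge_classes_def fun_eq_iff using uv(2) by (meson reachable_sym reachable_trans)
    then have "reachable T = reachable (T - {{u, v}})"
      using reachable_insert[of u v "T - {{u, v}}"] uv(1) by (simp add: insert_absorb)
    then have "?C (T - {{u, v}})" using T by auto
    then show False
      using min[of "T - {{u, v}}"] uv(1) fin
      by (metis card_Diff1_less leD)
  qed
  then show ?thesis
    using T spanning_trees_eq[OF assms(1)] assms(2) unfolding connected_graph_def by auto
qed

section \<open>The star-mesh transformation\<close>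

text \<open>Deletion-contraction for a list of weighted edges; the relation \<open>r\<close> records which
  vertices have been identified by contractions.  Parallel edges and loops are allowed.\<close>

fun tree_sum :: "'v set \<Rightarrow> ('v \<Rightarrow> 'v \<Rightarrow> bool) \<Rightarrow> ('v \<times> 'v \<times> real) list \<Rightarrow> real" where
  "tree_sum V r [] = of_bool (\<forall>p\<in>V. \<forall>q\<in>V. r p q)"
| "tree_sum V r ((u, v, w) # es) =
     tree_sum V r es + (if r u v then 0 else w * tree_sum V (merge_classes r u v) es)"

declare tree_sum.simps(1) [simp del]

lemma equivp_eqv: "equivp r \<Longrightarrow> r x y \<longleftrightarrow> r x = r y"
  by (rule equivp_def[THEN iffD1, rule_format])

text \<open>Both sides are the equivalence generated by \<open>r\<close> and the two pairs, so
  contractions commute.\<close>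

lemma merge_comm2:
  assumes "equivp r"
  shows "merge_classes (merge_classes r a b) c d = merge_classes (merge_classes r c d) a b"
  unfolding merge_classes_def fun_eq_iff using equivp_symp[OF assms] equivp_transp[OF assms] equivp_reflp[OF assms]
  by (intro allI) (smt (verit, ccfv_threshold))

lemma merge_cong:
  assumes "equivp r" "r a c" "r b d"
  shows "merge_classes r a b = merge_classes r c d"
  unfolding merge_classes_def fun_eq_iff using equivp_eqv[OF assms(1)] assms(2,3) by metis

lemma mergeI: "equivp r \<Longrightarrow> merge_classes r u v u v"
  by (simp add: merge_classes_def equivp_reflp)

text \<open>Both sides say that the two pairs join the same two classes, the case in which
  contracting either edge makes the other a loop.\<close>

lemma merge_swap_iff:
  assumes "equivp r" "\<not> r a b" "\<not> r c d"
  shows "merge_classes r a b c d \<longleftrightarrow> merge_classes r c d a b"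
  unfolding merge_classes_def using equivp_eqv[OF assms(1)] assms(2,3) by metis

lemma merge_extend: "r x y \<Longrightarrow> merge_classes r u v x y"
  by (simp add: merge_classes_def)

lemma tree_sum_swap:
  assumes r: "equivp r"
  shows "tree_sum V r (e # f # es) = tree_sum V r (f # e # es)"
proof -
  obtain a b x c d y where e: "e = (a, b, x)" "f = (c, d, y)"
    by (metis prod_cases3)
  show ?thesis
    using merge_swap_iff[OF r, of a b c d] merge_comm2[OF r, of a b c d]
    by (auto simp: e algebra_simps merge_extend)
qed

lemma tree_sum_Cons_cong:
  assumes "\<And>r. equivp r \<Longrightarrow> tree_sum V r es = tree_sum V r fs" "equivp r"
  shows "tree_sum V r (e # es) = tree_sum V r (e # fs)"
  using assms by (cases e) (auto simp: equivp_merge)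

lemma tree_sum_move:
  "equivp r \<Longrightarrow> tree_sum V r (es @ e # fs) = tree_sum V r (e # es @ fs)"
proof (induction es arbitrary: r)
  case Nil
  then show ?case by simp
next
  case (Cons f es)
  have "tree_sum V r (f # es @ e # fs) = tree_sum V r (f # e # es @ fs)"
    using Cons tree_sum_Cons_cong by blast
  then show ?case
    using tree_sum_swap[OF Cons.prems] by (metis append_Cons)
qed

text \<open>Order invariance is what allows a mesh edge to be brought next to the old edge parallel
  to it.\<close>

lemma tree_sum_mset:
  "mset es = mset fs \<Longrightarrow> equivp r \<Longrightarrow> tree_sum V r es = tree_sum V r fs"
proof (induction es arbitrary: fs r)
  case Nil
  then show ?case by simp
next
  case (Cons e es)
  then have "e \<in> set fs"
    by (metis list.set_intros(1) set_mset_mset)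
  then obtain gs hs where fs: "fs = gs @ e # hs"
    by (meson split_list)
  then have "mset es = mset (gs @ hs)" using Cons.prems by simp
  then have "tree_sum V r (e # es) = tree_sum V r (e # gs @ hs)"
    using Cons.IH Cons.prems(2) tree_sum_Cons_cong by blast
  then show ?case
    using tree_sum_move[OF Cons.prems(2)] fs by metis
qed

lemma tree_sum_parallel:
  assumes "equivp r"
  shows "tree_sum V r ((a, b, x) # (a, b, y) # es) = tree_sum V r ((a, b, x + y) # es)"
  using mergeI[OF assms, of a b] by (auto simp: algebra_simps)

lemma tree_sum_flip: "equivp r \<Longrightarrow> tree_sum V r ((a, b, x) # es) = tree_sum V r ((b, a, x) # es)"
  by (auto simp: merge_commute[of r a b] intro: equivp_symp)

lemma tree_sum_drop_zero:
  assumes "equivp r"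
  shows "tree_sum V r (es @ (a, b, 0) # fs) = tree_sum V r (es @ fs)"
  using tree_sum_move[OF assms] by simp

lemma tree_sum_drop_loop:
  assumes "equivp r"
  shows "tree_sum V r (es @ (a, a, x) # fs) = tree_sum V r (es @ fs)"
  using tree_sum_move[OF assms] by (simp add: equivp_reflp[OF assms])

text \<open>The vertex \<open>n\<close> being a class of its own, contracting an edge \<open>na\<close> deletes \<open>n\<close>
  and turns the other edges \<open>nb\<close> into edges \<open>ab\<close>.\<close>

lemma merge_isolated:
  assumes r: "equivp r" and iso: "\<And>p. r n p \<longleftrightarrow> p = n" and "n \<noteq> p" "n \<noteq> q"
  shows "merge_classes r n a p q \<longleftrightarrow> r p q"
  unfolding merge_classes_def using iso assms(3,4) equivp_symp[OF r] by metis

lemma tree_sum_contract: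
  assumes "equivp r" "\<And>p. r n p \<longleftrightarrow> p = n" "n \<notin> V" "a \<in> V"
    "\<forall>(b, c, y)\<in>set es. b \<in> V \<and> c \<in> V"
  shows "tree_sum (insert n V) (merge_classes r n a) es = tree_sum V r es"
  using assms
proof (induction es arbitrary: r)
  case Nil
  have an: "a \<noteq> n" using Nil by auto
  have "(\<forall>p\<in>insert n V. \<forall>q\<in>insert n V. merge_classes r n a p q) \<longleftrightarrow> (\<forall>p\<in>V. \<forall>q\<in>V. r p q)" (is "?L \<longleftrightarrow> ?R")
  proof
    show ?R if ?L
      using that merge_isolated[OF Nil(1,2)] Nil(3) by (metis insertCI)
    have na: "merge_classes r n a n a" using mergeI[OF Nil(1)] .
    show ?L if R: ?R
    proof -
      have m: "merge_classes r n a p a" if "p \<in> insert n V" for p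
        using that R na Nil(4) by (auto intro: merge_extend)
      show ?thesis
        using m equivp_merge[OF Nil(1)] by (meson equivp_symp equivp_transp)
    qed
  qed
  then show ?case by (simp add: tree_sum.simps(1))
next
  case (Cons e es)
  obtain b c y where e: "e = (b, c, y)" by (metis prod_cases3)
  have bc: "b \<in> V" "c \<in> V" "b \<noteq> n" "c \<noteq> n" using Cons.prems e by auto
  have iso: "merge_classes r b c n p \<longleftrightarrow> p = n" for p
    using bc Cons.prems(2) by (auto simp: merge_classes_def)
  have "tree_sum (insert n V) (merge_classes (merge_classes r n a) b c) es = tree_sum V (merge_classes r b c) es"
    unfolding merge_comm2[OF Cons.prems(1), of n a b c]
    using Cons.IH[OF equivp_merge[OF Cons.prems(1)] iso] Cons.prems by simp
  then show ?case
    using Cons merge_isolated[OF Cons.prems(1,2), of b c a] bc by (simp add: e)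
qed

lemma tree_sum_contract_edge:
  assumes r: "equivp r" and iso: "\<And>p. r n p \<longleftrightarrow> p = n" and "b \<noteq> n"
  shows "tree_sum V (merge_classes r n a) ((n, b, y) # es) = tree_sum V (merge_classes r n a) ((a, b, y) # es)"
proof -
  let ?r = "merge_classes r n a"
  have na: "?r n a" using mergeI[OF r] .
  have eq: "?r n = ?r a"
    using equivp_eqv[OF equivp_merge[OF r]] na by metis
  have "merge_classes ?r n b = merge_classes ?r a b"
    using merge_cong[OF equivp_merge[OF r] na equivp_reflp[OF equivp_merge[OF r]]] .
  then show ?thesis by (simp add: eq)
qed

lemma tree_sum_isolated:
  assumes "\<And>p. r n p \<longleftrightarrow> p = n" "n \<notin> V" "a \<in> V"
  shows "tree_sum (insert n V) r [] = 0"
  using assms by (auto simp: tree_sum.simps(1))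

text \<open>The terms are sorted by the first star edge that is contracted. Deleting all three
  leaves \<open>n\<close> isolated and contributes 0.\<close>

lemma tree_sum_star3:
  assumes r: "equivp r" and iso: "\<And>p. r n p \<longleftrightarrow> p = n" and V: "n \<notin> V" "a \<in> V" "b \<in> V" "c \<in> V"
  shows "tree_sum (insert n V) r [(n, a, x), (n, b, y), (n, c, z)] =
    z * tree_sum V r [] + y * tree_sum V r [(b, c, z)] + x * tree_sum V r [(a, b, y), (a, c, z)]"
proof -
  have [simp]: "\<not> r n a" "\<not> r n b" "\<not> r n c" "b \<noteq> n" "c \<noteq> n" "a \<noteq> n" "n \<noteq> a"
    using iso V by auto
  note contr = tree_sum_contract_edge[OF r iso] tree_sum_contract[OF r iso V(1)]
  have 1: "tree_sum (insert n V) (merge_classes r n a) [(n, b, y), (n, c, z)] = tree_sum V r [(a, b, y), (a, c, z)]"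
  proof -
    have "tree_sum (insert n V) (merge_classes r n a) [(n, b, y), (n, c, z)] =
        tree_sum (insert n V) (merge_classes r n a) [(n, c, z), (a, b, y)]"
      unfolding contr(1)[OF \<open>b \<noteq> n\<close>] by (rule tree_sum_swap[OF equivp_merge[OF r]])
    also have "\<dots> = tree_sum (insert n V) (merge_classes r n a) [(a, c, z), (a, b, y)]"
      by (rule contr) simp
    also have "\<dots> = tree_sum V r [(a, c, z), (a, b, y)]"
      by (rule contr(2)) (use V in auto)
    finally show ?thesis using tree_sum_swap[OF r] by metis
  qed
  have 2: "tree_sum (insert n V) (merge_classes r n b) [(n, c, z)] = tree_sum V r [(b, c, z)]"
    unfolding contr(1)[OF \<open>c \<noteq> n\<close>] by (rule contr(2)) (use V in auto)
  have 3: "tree_sum (insert n V) (merge_classes r n c) [] = tree_sum V r []"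
    by (rule contr(2)) (use V in auto)
  show ?thesis
    unfolding tree_sum.simps(2)[of "insert n V" r n] 1 2 3
    using tree_sum_isolated[of r n V a] iso V by simp
qed

text \<open>Both sides are expanded over the ways of joining the classes of \<open>a, b, c\<close>:
  none, one of three pairs, or all, with values \<open>A\<close>, \<open>B1\<close>,
  \<open>B2\<close>, \<open>B3\<close>, \<open>B\<close>. After multiplication by \<open>s\<close>
  the coefficients on both sides are \<open>s\<close>, \<open>x * y\<close>, \<open>y * z\<close>,
  \<open>x * z\<close> and \<open>x * y * z\<close>. Where \<open>r\<close> already identifies some
  of the vertices, the corresponding terms drop out on both sides.\<close>

lemma star_mesh_base:
  assumes r: "equivp r" and iso: "\<And>p. r n p \<longleftrightarrow> p = n" and V: "n \<notin> V" "a \<in> V" "b \<in> V" "c \<in> V"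
    and s: "s = x + y + z" "s \<noteq> 0"
  shows "tree_sum (insert n V) r [(n, a, x), (n, b, y), (n, c, z)] =
    s * tree_sum V r [(a, b, x * y / s), (b, c, y * z / s), (a, c, x * z / s)]"
proof -
  note eqv = equivp_eqv[OF r]
  note [simp] = mergeI[OF r] merge_extend
  have m: "merge_classes (merge_classes r a b) b c a c" "merge_classes (merge_classes r a b) b c = merge_classes (merge_classes r a b) a c"
    "merge_classes (merge_classes r b c) a c = merge_classes (merge_classes r a b) a c"
  proof -
    have ab: "merge_classes r a b a b" by simp
    have rr: "equivp (merge_classes r a b)" using equivp_merge[OF r] .
    show "merge_classes (merge_classes r a b) b c = merge_classes (merge_classes r a b) a c"
      using merge_cong[OF rr] ab rr equivp_reflp equivp_symp by metis
    then show "merge_classes (merge_classes r a b) b c a c" using mergeI[OF rr, of a c] by simp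
    have "merge_classes (merge_classes r b c) a c = merge_classes (merge_classes r b c) a b"
      using merge_cong[OF equivp_merge[OF r]] mergeI[OF r, of b c] equivp_merge[OF r] equivp_reflp equivp_symp
      by metis
    also have "\<dots> = merge_classes (merge_classes r a b) b c" using merge_comm2[OF r] .
    finally show "merge_classes (merge_classes r b c) a c = merge_classes (merge_classes r a b) a c"
      using \<open>merge_classes (merge_classes r a b) b c = merge_classes (merge_classes r a b) a c\<close> by simp
  qed
  have bc: "merge_classes r a b b c \<longleftrightarrow> r b c \<or> r a c" "merge_classes r a b a c \<longleftrightarrow> r b c \<or> r a c"
    "merge_classes r b c a c \<longleftrightarrow> r a b \<or> r a c"
    unfolding merge_classes_def using eqv by metis+
  have e: "r a b \<Longrightarrow> r a c = r b c" "r b c \<Longrightarrow> r a c = r a b" 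
    using eqv by metis+
  have e1: "r a b \<Longrightarrow> merge_classes r a c = merge_classes r b c" "r b c \<Longrightarrow> merge_classes r a c = merge_classes r a b"
      "r a c \<Longrightarrow> merge_classes r b c = merge_classes r a b"
    using merge_cong[OF r] equivp_reflp[OF r] equivp_symp[OF r] merge_commute by metis+
  define A B1 B2 B3 B where "A = tree_sum V r []" "B1 = tree_sum V (merge_classes r a b) []"
    "B2 = tree_sum V (merge_classes r b c) []" "B3 = tree_sum V (merge_classes r a c) []" "B = tree_sum V (merge_classes (merge_classes r a b) a c) []"
  note B = this
  have "tree_sum V r [(a, b, p), (b, c, q), (a, c, t)] =
     A + (if r a b then 0 else p * B1) + (if r b c then 0 else q * B2) + (if r a c then 0 else t * B3)
     + (if r a b \<or> r b c \<or> r a c then 0 else (p * q + p * t + q * t) * B)" for p q t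
    using e m bc unfolding B by (simp add: algebra_simps)
  moreover have "tree_sum V r [(a, b, y), (a, c, z)] =
     A + (if r a b then 0 else y * B1) + (if r a c then 0 else z * B3)
     + (if r a b \<or> r b c \<or> r a c then 0 else y * z * B)"
    using e bc unfolding B by (simp add: algebra_simps)
  moreover have "tree_sum V r [(b, c, z)] = A + (if r b c then 0 else z * B2)"
    unfolding B by simp
  \<comment> \<open>The three two-edge trees of the mesh triangle share the factor
    \<open>x + y + z\<close>, which cancels one \<open>s\<close>; what remains is the term in which
    all three star edges are used.\<close>
  moreover have "s * ((x * y / s) * (y * z / s) + (x * y / s) * (x * z / s) + (y * z / s) * (x * z / s)) = x * y * z"
  proof -
    have "(x * y / s) * (y * z / s) + (x * y / s) * (x * z / s) + (y * z / s) * (x * z / s) = x * y * z * (y + x + z) / (s * s)"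
      using s(2) by (simp add: divide_simps) (simp add: algebra_simps)
    also have "\<dots> = x * y * z / s" using s by (simp add: add.commute)
    finally show ?thesis using s(2) by simp
  qed
  ultimately show ?thesis
    unfolding tree_sum_star3[OF r iso V] using s(2)
    by (simp add: distrib_left mult.assoc[symmetric] del: tree_sum.simps)
       (auto simp: B(1)[symmetric] algebra_simps s(1))
qed

text \<open>Deleting or contracting an edge inside \<open>V\<close> leaves \<open>n\<close> a class
  of its own, so deletion-contraction of \<open>es\<close> reduces the claim to the bare
  star.\<close>

lemma star_mesh:
  assumes "equivp r" "\<And>p. r n p \<longleftrightarrow> p = n" and V: "n \<notin> V" "a \<in> V" "b \<in> V" "c \<in> V"
    and s: "s = x + y + z" "s \<noteq> 0"
    and "\<forall>(u, v, w)\<in>set es. u \<in> V \<and> v \<in> V"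
  shows "tree_sum (insert n V) r (es @ [(n, a, x), (n, b, y), (n, c, z)]) =
    s * tree_sum V r (es @ [(a, b, x * y / s), (b, c, y * z / s), (a, c, x * z / s)])"
  using assms(1,2,9)
proof (induction es arbitrary: r)
  case Nil
  then show ?case using star_mesh_base[OF Nil(1,2) V s] by simp
next
  case (Cons e es)
  obtain u v w where e: "e = (u, v, w)" by (metis prod_cases3)
  have uv: "u \<in> V" "v \<in> V" using Cons.prems e by auto
  have "merge_classes r u v n p \<longleftrightarrow> p = n" for p
    using uv Cons.prems(2) V(1) by (auto simp: merge_classes_def)
  then show ?case
    using Cons.IH[OF Cons.prems(1,2)] Cons.IH[OF equivp_merge[OF Cons.prems(1)]] Cons.prems(3)
    by (simp add: e algebra_simps)
qed

section \<open>From weighted edge lists to the spanning-tree polynomial\<close>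

abbreviation edges_of :: "('v \<times> 'v) list \<Rightarrow> 'v set list" where
  "edges_of es \<equiv> map (\<lambda>(u, v). {u, v}) es"

definition weighted :: "('v set \<Rightarrow> real) \<Rightarrow> ('v \<times> 'v) list \<Rightarrow> ('v \<times> 'v \<times> real) list" where
  "weighted w es = map (\<lambda>(u, v). (u, v, w {u, v})) es"

lemma weighted_simps [simp]:
  "weighted w [] = []"
  "weighted w ((u, v) # es) = (u, v, w {u, v}) # weighted w es"
  "weighted w (es @ fs) = weighted w es @ weighted w fs"
  by (auto simp: weighted_def)

lemma weighted_cong:
  "(\<And>e. e \<in> set (edges_of es) \<Longrightarrow> w e = w' e) \<Longrightarrow> weighted w es = weighted w' es"
  unfolding weighted_def by (rule map_cong) auto

text \<open>\<open>A\<close> collects the edges contracted so far. Splitting the sum by whether the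
  head edge lies in \<open>T\<close> reproduces deletion and contraction. If \<open>A\<close>
  already joins its ends, no forest containing \<open>A\<close> can use it, which is the loop
  case.\<close>

lemma tree_sum_weighted:
  assumes "distinct (edges_of es)" "A \<inter> set (edges_of es) = {}" "forest A"
  shows "tree_sum V (reachable A) (weighted w es) =
    (\<Sum>T | T \<subseteq> set (edges_of es) \<and> forest (A \<union> T) \<and> (\<forall>p\<in>V. \<forall>q\<in>V. reachable (A \<union> T) p q). \<Prod>e\<in>T. w e)"
  using assms
proof (induction es arbitrary: A)
  case Nil
  have "{T. T \<subseteq> set (edges_of []) \<and> forest (A \<union> T) \<and> (\<forall>p\<in>V. \<forall>q\<in>V. reachable (A \<union> T) p q)} =
      (if \<forall>p\<in>V. \<forall>q\<in>V. reachable A p q then {{}} else {})"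
    using Nil by auto
  then show ?case by (simp add: tree_sum.simps(1))
next
  case (Cons e es)
  obtain u v where e: "e = (u, v)" by (metis prod.exhaust)
  let ?S = "set (edges_of es)" and ?e = "{u, v}"
  let ?P = "\<lambda>A T. forest (A \<union> T) \<and> (\<forall>p\<in>V. \<forall>q\<in>V. reachable (A \<union> T) p q)"
  have eS: "?e \<notin> ?S" "?e \<notin> A" and d: "distinct (edges_of es)" "A \<inter> ?S = {}"
    using Cons.prems by (auto simp: e)
  have fin: "finite {T. T \<subseteq> ?S \<and> Q T}" for Q
    by (rule finite_subset[of _ "Pow ?S"]) auto
  have split: "{T. T \<subseteq> set (edges_of (e # es)) \<and> ?P A T} =
      {T. T \<subseteq> ?S \<and> ?P A T} \<union> insert ?e ` {T. T \<subseteq> ?S \<and> ?P (insert ?e A) T}" (is "?L = ?A \<union> ?B")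
  proof (intro equalityI subsetI)
    fix T assume T: "T \<in> ?L"
    show "T \<in> ?A \<union> ?B"
    proof (cases "?e \<in> T")
      case True
      then have "T = insert ?e (T - {?e})" "insert ?e A \<union> (T - {?e}) = A \<union> T" by auto
      moreover have "T - {?e} \<subseteq> ?S" using T e by auto
      ultimately show ?thesis using T by (intro UnI2 image_eqI[of _ _ "T - {?e}"]) auto
    next
      case False
      then show ?thesis using T e by auto
    qed
  qed (auto simp: e)
  have disj: "?A \<inter> ?B = {}" using eS by auto
  have inj: "inj_on (insert ?e) {T. T \<subseteq> ?S \<and> ?P (insert ?e A) T}"
  proof (rule inj_onI)
    fix S T
    assume "S \<in> {T. T \<subseteq> ?S \<and> ?P (insert ?e A) T}" "T \<in> {T. T \<subseteq> ?S \<and> ?P (insert ?e A) T}"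
      and eq: "insert ?e S = insert ?e T"
    then have "?e \<notin> S" "?e \<notin> T" using eS(1) by auto
    with eq show "S = T" by (simp add: insert_ident)
  qed
  have "(\<Sum>T\<in>?L. \<Prod>e\<in>T. w e) = (\<Sum>T\<in>?A. \<Prod>e\<in>T. w e) + (\<Sum>T\<in>?B. \<Prod>e\<in>T. w e)"
    unfolding split by (rule sum.union_disjoint[OF fin finite_imageI[OF fin] disj])
  also have "(\<Sum>T\<in>?B. \<Prod>e\<in>T. w e) =
      (\<Sum>T | T \<subseteq> ?S \<and> ?P (insert ?e A) T. \<Prod>e\<in>insert ?e T. w e)"
    by (simp only: sum.reindex[OF inj] o_def)
  also have "(\<Sum>T | T \<subseteq> ?S \<and> ?P (insert ?e A) T. \<Prod>e\<in>insert ?e T. w e) =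
      (\<Sum>T | T \<subseteq> ?S \<and> ?P (insert ?e A) T. w ?e * (\<Prod>e\<in>T. w e))"
  proof (rule sum.cong)
    fix T assume "T \<in> {T. T \<subseteq> ?S \<and> ?P (insert ?e A) T}"
    then have "finite T" "?e \<notin> T" using eS finite_subset by blast+
    then show "(\<Prod>e\<in>insert ?e T. w e) = w ?e * (\<Prod>e\<in>T. w e)" by simp
  qed simp
  also have "\<dots> = (if reachable A u v then 0 else w ?e * tree_sum V (reachable (insert ?e A)) (weighted w es))"
  proof (cases "reachable A u v")
    case True
    have "\<not> forest (insert ?e A \<union> T)" for T
    proof
      assume f: "forest (insert ?e A \<union> T)"
      have "reachable (insert ?e A \<union> T - {?e}) u v"
        using True eS by (intro reachable_mono[OF _ True]) auto
      then show False using f unfolding forest_def by auto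
    qed
    then show ?thesis using True by simp
  next
    case False
    then have "forest (insert ?e A)" using forest_insert eS Cons.prems by metis
    moreover have "insert ?e A \<inter> ?S = {}" using eS d by auto
    ultimately show ?thesis
      using Cons.IH[OF d(1)] False by (simp add: sum_distrib_left)
  qed
  finally show ?case
    using Cons.IH[OF d Cons.prems(3)] by (simp add: e reachable_insert)
qed

lemma reachable_empty: "reachable {} p q \<longleftrightarrow> p = q"
  by (simp add: reachable_def)

lemma spanning_tree_poly_eq_tree_sum:
  assumes "simple_graph V E" "V \<noteq> {}" "distinct (edges_of es)" "set (edges_of es) = E"
  shows "spanning_tree_poly V E w = tree_sum V (reachable {}) (weighted w es)"
  using tree_sum_weighted[OF assms(3), of "{}" V w] assms(4)
  unfolding spanning_tree_poly_def spanning_trees_eq[OF assms(1,2)] by simp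

lemma simple_graph_edge_list:
  assumes "simple_graph V E"
  obtains es where "distinct (edges_of es)" "set (edges_of es) = E" "\<forall>(u, v)\<in>set es. u \<in> V \<and> v \<in> V"
proof -
  obtain l where l: "set l = E" "distinct l"
    using finite_distinct_list[OF simple_graph_finite_edges[OF assms]] by blast
  have "\<exists>p. (\<lambda>(u, v). {u, v}) p = e" if "e \<in> E" for e
  proof -
    have "card e = 2" using that assms by (simp add: simple_graph_def)
    then obtain u v where "e = {u, v}" by (auto simp: card_2_iff)
    then show ?thesis by (intro exI[of _ "(u, v)"]) simp
  qed
  then obtain f where f: "\<And>e. e \<in> E \<Longrightarrow> (\<lambda>(u, v). {u, v}) (f e) = e" by metis
  have fl: "edges_of (map f l) = l"
    unfolding map_map using f l(1) by (intro map_idI) auto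
  have "u \<in> V \<and> v \<in> V" if uv: "(u, v) \<in> set (map f l)" for u v
  proof -
    obtain e where "e \<in> E" "f e = (u, v)" using uv l(1) by auto
    then have "{u, v} \<in> E" using f by force
    then show ?thesis using assms by (auto simp: simple_graph_def)
  qed
  then show ?thesis using that[of "map f l"] unfolding fl using l by blast
qed

text \<open>The additional edge is moved next to its parallel and the weights are added. For
  \<open>a = b\<close> it is a loop and vanishes, and the changed weight is invisible because no
  listed edge is a singleton.\<close>

lemma tree_sum_absorb:
  assumes r: "equivp r" and d: "distinct (edges_of es)" and ab: "a \<noteq> b \<longrightarrow> {a, b} \<in> set (edges_of es)"
    and sing: "\<And>a. {a} \<notin> set (edges_of es)"
  shows "tree_sum V r (weighted w es @ (a, b, m) # fs) =
    tree_sum V r (weighted (\<lambda>e. w e + (if e = {a, b} then m else 0)) es @ fs)"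
proof (cases "a = b")
  case True
  have "weighted (\<lambda>e. w e + (if e = {a, b} then m else 0)) es = weighted w es"
    by (rule weighted_cong) (use True sing[of b] in auto)
  then show ?thesis using tree_sum_drop_loop[OF r] True by metis
next
  case False
  obtain p q where pq: "(p, q) \<in> set es" "{p, q} = {a, b}"
    using ab False by auto
  then obtain es1 es2 where es: "es = es1 @ (p, q) # es2" by (meson split_list)
  let ?w = "\<lambda>e. w e + (if e = {a, b} then m else 0)"
  have notin: "{a, b} \<notin> set (edges_of es1)" "{a, b} \<notin> set (edges_of es2)"
    using d pq(2) by (auto simp: es)
  have w: "weighted ?w xs = weighted w xs" if "{a, b} \<notin> set (edges_of xs)" for xs
  proof (rule weighted_cong)
    fix e assume "e \<in> set (edges_of xs)"
    with that have "e \<noteq> {a, b}" by blast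
    then show "?w e = w e" by simp
  qed
  let ?fs = "weighted w es1 @ weighted w es2 @ fs"
  have "tree_sum V r (weighted w es @ (a, b, m) # fs) = tree_sum V r ((a, b, m) # (p, q, w {a, b}) # ?fs)"
    by (rule tree_sum_mset) (auto simp: es pq r)
  also have "\<dots> = tree_sum V r ((p, q, m) # (p, q, w {a, b}) # ?fs)"
    using pq(2) tree_sum_flip[OF r] by (auto simp: doubleton_eq_iff simp del: tree_sum.simps)
  also have "\<dots> = tree_sum V r ((p, q, ?w {p, q}) # ?fs)"
    unfolding tree_sum_parallel[OF r] using pq(2) by (simp add: add.commute)
  also have "\<dots> = tree_sum V r (weighted ?w es @ fs)"
    by (rule tree_sum_mset) (auto simp: es w[OF notin(1)] w[OF notin(2)] r pq(2))
  finally show ?thesis .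
qed

lemma star_mesh_tree_poly:
  assumes G: "simple_graph V E" and n: "n \<notin> V" and abc: "a \<in> V" "b \<in> V" "c \<in> V"
    and K: "a \<noteq> b \<Longrightarrow> {a, b} \<in> E" "b \<noteq> c \<Longrightarrow> {b, c} \<in> E" "a \<noteq> c \<Longrightarrow> {a, c} \<in> E"
    and x: "x = w {n, a}" and y: "y = (if b = a then 0 else w {n, b})"
    and z: "z = (if c = a \<or> c = b then 0 else w {n, c})"
    and s: "s = x + y + z" "s \<noteq> 0"
  shows "spanning_tree_poly (insert n V) (E \<union> {{n, a}, {n, b}, {n, c}}) w =
    s * spanning_tree_poly V E (\<lambda>e. w e + (if e = {a, b} then x * y / s else 0) +
      (if e = {b, c} then y * z / s else 0) + (if e = {a, c} then x * z / s else 0))"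
proof -
  obtain es where es: "distinct (edges_of es)" "set (edges_of es) = E"
    "\<forall>(u, v)\<in>set es. u \<in> V \<and> v \<in> V"
    using simple_graph_edge_list[OF G] .
  \<comment> \<open>Each edge at \<open>n\<close> is listed once even if \<open>a, b, c\<close>
    coincide. The omitted ones reappear below with weight 0, so that \<open>star_mesh\<close> always
    sees three.\<close>
  define st where "st = (n, a) # (if b = a then [] else [(n, b)]) @ (if c = a \<or> c = b then [] else [(n, c)])"
  have r: "equivp (reachable {})" by (rule equivp_reachable)
  have nE: "e \<in> E \<Longrightarrow> n \<notin> e" for e using G n by (auto simp: simple_graph_def)
  have sing: "{p} \<notin> E" for p using G by (force simp: simple_graph_def)
  have K': "a \<noteq> b \<longrightarrow> {a, b} \<in> E" "b \<noteq> c \<longrightarrow> {b, c} \<in> E" "a \<noteq> c \<longrightarrow> {a, c} \<in> E"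
    using K by auto
  note absorb = tree_sum_absorb[OF r es(1), unfolded es(2), OF _ sing]
  have "simple_graph (insert n V) (E \<union> {{n, a}, {n, b}, {n, c}})"
    using G n abc by (auto simp: simple_graph_def card_insert_if)
  moreover have "distinct (edges_of (es @ st))"
    using es n abc nE by (auto simp: st_def doubleton_eq_iff)
  moreover have "set (edges_of (es @ st)) = E \<union> {{n, a}, {n, b}, {n, c}}"
    using es by (auto simp: st_def)
  ultimately have "spanning_tree_poly (insert n V) (E \<union> {{n, a}, {n, b}, {n, c}}) w =
      tree_sum (insert n V) (reachable {}) (weighted w (es @ st))"
    by (intro spanning_tree_poly_eq_tree_sum) auto
  also have "\<dots> = tree_sum (insert n V) (reachable {}) (weighted w es @ [(n, a, x), (n, b, y), (n, c, z)])"
    using tree_sum_drop_zero[OF r, of "insert n V" "weighted w es @ [(n, a, x)]" n b "[(n, c, z)]"]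
      tree_sum_drop_zero[OF r, of "insert n V" "weighted w es @ [(n, a, x), (n, b, y)]" n c "[]"]
      tree_sum_drop_zero[OF r, of "insert n V" "weighted w es @ [(n, a, x)]" n c "[]"]
    unfolding st_def x y z by (cases "b = a"; cases "c = a"; cases "c = b") (simp_all del: tree_sum.simps)
  also have "\<dots> = s * tree_sum V (reachable {}) (weighted w es @ [(a, b, x * y / s), (b, c, y * z / s), (a, c, x * z / s)])"
    by (rule star_mesh[OF r _ n abc s]) (use es(3) in \<open>auto simp: reachable_empty weighted_def\<close>)
  also have "\<dots> = s * tree_sum V (reachable {}) (weighted (\<lambda>e. w e + (if e = {a, b} then x * y / s else 0) +
      (if e = {b, c} then y * z / s else 0) + (if e = {a, c} then x * z / s else 0)) es)"
    unfolding absorb[OF K'(1)] absorb[OF K'(2)] absorb[OF K'(3)] append_Nil2 ..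
  also have "\<dots> = s * spanning_tree_poly V E (\<lambda>e. w e + (if e = {a, b} then x * y / s else 0) +
      (if e = {b, c} then y * z / s else 0) + (if e = {a, c} then x * z / s else 0))"
    using spanning_tree_poly_eq_tree_sum[OF G _ es(1,2)] abc by force
  finally show ?thesis .
qed

section \<open>Laplace transforms are completely monotone\<close>

lemma exp_diff_le:
  fixes p q r :: real
  assumes "r \<le> p" "r \<le> q"
  shows "\<bar>exp (- p) - exp (- q)\<bar> \<le> \<bar>p - q\<bar> * exp (- r)"
proof -
  have *: "exp (- p) - exp (- q) \<le> (q - p) * exp (- r)" if "r \<le> p" "p \<le> q" for p q
  proof -
    have "exp (- p) - exp (- q) = exp (- p) * (1 - exp (p - q))"
      by (simp add: right_diff_distrib flip: exp_add)
    also have "\<dots> \<le> exp (- p) * (q - p)"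
    proof (rule mult_left_mono)
      show "1 - exp (p - q) \<le> q - p"
        using exp_ge_add_one_self[of "p - q"] by linarith
    qed simp
    also have "\<dots> \<le> exp (- r) * (q - p)"
      using that by (intro mult_right_mono) auto
    finally show ?thesis by (simp add: mult.commute)
  qed
  show ?thesis
  proof (cases "p \<le> q")
    case True
    then show ?thesis using *[of p q] assms by (simp add: abs_if)
  next
    case False
    then show ?thesis using *[of q p] assms by (simp add: abs_if)
  qed
qed

text \<open>A crude remainder is enough: the factor exp |y| is later absorbed by moving the
  evaluation point of the Laplace transform closer to 0.\<close>

lemma exp_taylor1_le:
  fixes y :: real
  shows "\<bar>exp (- y) - 1 + y\<bar> \<le> y\<^sup>2 * exp \<bar>y\<bar>"
proof -
  have "exp (- y) - 1 = exp (- y) * (1 - exp y)"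
    by (simp add: right_diff_distrib flip: exp_add)
  also have "\<dots> \<le> exp (- y) * (- y)"
  proof (rule mult_left_mono)
    show "1 - exp y \<le> - y"
      using exp_ge_add_one_self[of y] by linarith
  qed simp
  finally have "exp (- y) - 1 + y \<le> y * (1 - exp (- y))"
    by (simp add: algebra_simps)
  also have "\<dots> \<le> \<bar>y\<bar> * \<bar>exp (- 0) - exp (- y)\<bar>"
    by (metis abs_ge_self abs_mult exp_zero minus_zero)
  also have "\<dots> \<le> \<bar>y\<bar> * (\<bar>0 - y\<bar> * exp (- (- \<bar>y\<bar>)))"
    by (intro mult_left_mono exp_diff_le) auto
  also have "\<dots> = y\<^sup>2 * exp \<bar>y\<bar>"
    by (simp add: power2_eq_square)
  finally show ?thesis
    using exp_ge_add_one_self[of "- y"] by simp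
qed

lemma abs_lebesgue_integral_le:
  fixes f g :: "'a \<Rightarrow> real"
  assumes "integrable M f" "integrable M g" "\<And>t. t \<in> space M \<Longrightarrow> \<bar>f t\<bar> \<le> g t"
  shows "\<bar>\<integral>t. f t \<partial>M\<bar> \<le> (\<integral>t. g t \<partial>M)"
proof -
  have "(\<integral>t. \<bar>f t\<bar> \<partial>M) \<le> (\<integral>t. g t \<partial>M)"
    using assms by (intro integral_mono) auto
  then show ?thesis using integral_abs_bound[of M f] by linarith
qed

context
  fixes E :: "'e set" and M :: "('e \<Rightarrow> real) measure"
  assumes fin: "finite E"
    and meas [measurable]: "\<And>e. (\<lambda>t. t e) \<in> borel_measurable M"
    and nonneg: "\<And>t e. t \<in> space M \<Longrightarrow> e \<in> E \<Longrightarrow> 0 \<le> t e"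
    and int: "\<And>x. \<forall>e\<in>E. 0 < x e \<Longrightarrow> integrable M (\<lambda>t. exp (- (\<Sum>e\<in>E. x e * t e)))"
begin

text \<open>Up to the sign \<open>(-1) ^ length es\<close>, the iterated partial derivative of the
  Laplace transform along \<open>es\<close>, as differentiation under the integral predicts
  it.\<close>

definition laplace_moment :: "'e list \<Rightarrow> ('e \<Rightarrow> real) \<Rightarrow> real" where
  "laplace_moment es x = (\<integral>t. prod_list (map t es) * exp (- (\<Sum>e\<in>E. x e * t e)) \<partial>M)"

lemma measurable_prod_list [measurable]: "(\<lambda>t. prod_list (map t es)) \<in> borel_measurable M"
  by (induction es) auto

lemma prod_list_nonneg: "t \<in> space M \<Longrightarrow> es \<in> lists E \<Longrightarrow> 0 \<le> prod_list (map t es)"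
  by (induction es) (auto simp: nonneg)

lemma sum_upd:
  assumes "e \<in> E"
  shows "(\<Sum>i\<in>E. (x(e := s)) i * t i) = (\<Sum>i\<in>E. x i * t i) + (s - x e) * (t e :: real)"
proof -
  have "(\<Sum>i\<in>E. (x(e := s)) i * t i) = s * t e + (\<Sum>i\<in>E - {e}. x i * t i)"
    by (subst sum.remove[OF fin assms]) (auto intro: sum.cong)
  moreover have "(\<Sum>i\<in>E. x i * t i) = x e * t e + (\<Sum>i\<in>E - {e}. x i * t i)"
    by (rule sum.remove[OF fin assms])
  ultimately show ?thesis by (simp add: algebra_simps)
qed

text \<open>Half of \<open>x e\<close> is spent on absorbing the factor \<open>t e\<close> into an
  exponential; the induction hypothesis is applied at the point where the other half
  remains.\<close>

lemma integrable_moment: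
  assumes "es \<in> lists E" "\<forall>e\<in>E. 0 < x e"
  shows "integrable M (\<lambda>t. prod_list (map t es) * exp (- (\<Sum>e\<in>E. x e * t e)))"
  using assms
proof (induction es arbitrary: x rule: list.induct)
  case Nil
  then show ?case by (simp add: int)
next
  case (Cons e es)
  have e: "e \<in> E" and es: "es \<in> lists E" and xe: "0 < x e" using Cons.prems by auto
  let ?x = "x(e := x e / 2)"
  have "integrable M (\<lambda>t. 2 / x e * (prod_list (map t es) * exp (- (\<Sum>e\<in>E. ?x e * t e))))"
    by (intro integrable_mult_right Cons.IH) (use Cons.prems in auto)
  then show ?case
  proof (rule Bochner_Integration.integrable_bound)
    show "AE t in M. norm (prod_list (map t (e # es)) * exp (- (\<Sum>e\<in>E. x e * t e)))
        \<le> norm (2 / x e * (prod_list (map t es) * exp (- (\<Sum>e\<in>E. ?x e * t e))))"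
    proof (rule AE_I2)
      fix t assume t: "t \<in> space M"
      have "x e / 2 * t e \<le> exp (x e / 2 * t e)"
        using exp_ge_add_one_self[of "x e / 2 * t e"] by linarith
      then have "t e \<le> 2 / x e * exp (x e / 2 * t e)"
        using xe by (simp add: field_simps)
      then have "t e * exp (- (\<Sum>i\<in>E. x i * t i)) \<le> 2 / x e * exp (x e / 2 * t e) * exp (- (\<Sum>i\<in>E. x i * t i))"
        by (intro mult_right_mono) auto
      also have "\<dots> = 2 / x e * exp (- (\<Sum>e\<in>E. ?x e * t e))"
        unfolding sum_upd[OF e] by (simp add: field_simps flip: exp_add)
      finally have "prod_list (map t es) * (t e * exp (- (\<Sum>i\<in>E. x i * t i))) \<le>
          prod_list (map t es) * (2 / x e * exp (- (\<Sum>e\<in>E. ?x e * t e)))"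
        using prod_list_nonneg[OF t es] by (intro mult_left_mono)
      then show "norm (prod_list (map t (e # es)) * exp (- (\<Sum>e\<in>E. x e * t e)))
        \<le> norm (2 / x e * (prod_list (map t es) * exp (- (\<Sum>e\<in>E. ?x e * t e))))"
        using prod_list_nonneg[OF t es] nonneg[OF t e] xe
        by (simp add: abs_mult mult_ac)
    qed
  qed simp
qed

lemma laplace_moment_nonneg: "es \<in> lists E \<Longrightarrow> 0 \<le> laplace_moment es x"
  unfolding laplace_moment_def by (rule Bochner_Integration.integral_nonneg) (simp add: prod_list_nonneg)

text \<open>Differentiation under the integral with an explicit error \<open>h\<^sup>2 * C\<close>:
  for |h| below half of \<open>x e\<close>, the Taylor remainder is dominated by the second moment
  at the point with \<open>x e\<close> halved.\<close>

lemma has_derivative_laplace_moment: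
  assumes es: "es \<in> lists E" and e: "e \<in> E" and x: "\<forall>e\<in>E. 0 < x e"
  shows "((\<lambda>s. laplace_moment es (x(e := s))) has_real_derivative - laplace_moment (e # es) x) (at (x e))"
proof -
  let ?a = "x e" and ?x = "x(e := x e / 2)"
  define C where "C = laplace_moment (e # e # es) ?x"
  have bound: "\<bar>laplace_moment es (x(e := ?a + h)) - laplace_moment es x + h * laplace_moment (e # es) x\<bar>
      \<le> h\<^sup>2 * C" if h: "\<bar>h\<bar> < ?a / 2" for h
  proof -
    let ?F = "\<lambda>es x t. prod_list (map t es) * exp (- (\<Sum>e\<in>E. x e * t e))"
    have pos: "\<forall>i\<in>E. 0 < (x(e := ?a + h)) i" "\<forall>i\<in>E. 0 < ?x i"
      using x h e by auto
    have I: "integrable M (?F es (x(e := ?a + h)))" "integrable M (?F es x)" "integrable M (?F (e # es) x)"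
      "integrable M (?F (e # e # es) ?x)"
      using integrable_moment[OF es] integrable_moment[of "e # es"] integrable_moment[of "e # e # es"]
        pos x es e by (auto simp del: list.map prod_list.Cons fun_upd_apply)
    have diff: "laplace_moment es (x(e := ?a + h)) - laplace_moment es x + h * laplace_moment (e # es) x =
        (\<integral>t. ?F es (x(e := ?a + h)) t - ?F es x t + h * ?F (e # es) x t \<partial>M)"
      unfolding laplace_moment_def using I by simp
    have "\<bar>\<integral>t. ?F es (x(e := ?a + h)) t - ?F es x t + h * ?F (e # es) x t \<partial>M\<bar> \<le>
        (\<integral>t. h\<^sup>2 * ?F (e # e # es) ?x t \<partial>M)"
    proof (rule abs_lebesgue_integral_le)
      fix t assume t: "t \<in> space M"
      have "?F es (x(e := ?a + h)) t - ?F es x t + h * ?F (e # es) x t =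
          ?F es x t * (exp (- (h * t e)) - 1 + h * t e)"
        unfolding sum_upd[OF e] by (simp add: algebra_simps flip: exp_add)
      also have "\<bar>\<dots>\<bar> = ?F es x t * \<bar>exp (- (h * t e)) - 1 + h * t e\<bar>"
        using prod_list_nonneg[OF t es] by (simp add: abs_mult)
      also have "\<dots> \<le> ?F es x t * ((h * t e)\<^sup>2 * exp \<bar>h * t e\<bar>)"
        using prod_list_nonneg[OF t es] by (intro mult_left_mono exp_taylor1_le) auto
      also have "\<dots> \<le> ?F es x t * ((h * t e)\<^sup>2 * exp (?a / 2 * t e))"
      proof -
        have "\<bar>h\<bar> * t e \<le> ?a / 2 * t e"
          using h nonneg[OF t e] by (intro mult_right_mono) auto
        then show ?thesis
          using prod_list_nonneg[OF t es] nonneg[OF t e]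
          by (intro mult_left_mono) (auto simp: abs_mult)
      qed
      also have "\<dots> = h\<^sup>2 * ?F (e # e # es) ?x t"
        unfolding sum_upd[OF e] by (simp add: power2_eq_square algebra_simps flip: exp_add)
      finally show "\<bar>?F es (x(e := ?a + h)) t - ?F es x t + h * ?F (e # es) x t\<bar> \<le> h\<^sup>2 * ?F (e # e # es) ?x t" .
    qed (rule Bochner_Integration.integrable_add[OF Bochner_Integration.integrable_diff[OF I(1,2)]
          integrable_mult_right[OF I(3)]] integrable_mult_right[OF I(4)])+
    also have "\<dots> = h\<^sup>2 * C"
      unfolding C_def laplace_moment_def integral_mult_right_zero ..
    finally show ?thesis unfolding diff .
  qed
  have C: "0 \<le> C" unfolding C_def using es e by (intro laplace_moment_nonneg) auto
  have "((\<lambda>h. (laplace_moment es (x(e := ?a + h)) - laplace_moment es x) / h - - laplace_moment (e # es) x) \<longlongrightarrow> 0) (at 0)"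
  proof (rule Lim_null_comparison)
    show "\<forall>\<^sub>F h in at 0. norm ((laplace_moment es (x(e := ?a + h)) - laplace_moment es x) / h - - laplace_moment (e # es) x)
        \<le> \<bar>h\<bar> * C"
      unfolding eventually_at
    proof (intro exI[of _ "?a / 2"] conjI ballI impI)
      show "0 < ?a / 2" using x e by simp
      fix h :: real assume h: "h \<noteq> 0 \<and> dist h 0 < ?a / 2"
      let ?N = "laplace_moment es (x(e := ?a + h)) - laplace_moment es x + h * laplace_moment (e # es) x"
      have "(laplace_moment es (x(e := ?a + h)) - laplace_moment es x) / h - - laplace_moment (e # es) x = ?N / h"
        using h by (simp add: field_simps)
      also have "norm \<dots> \<le> h\<^sup>2 * C / \<bar>h\<bar>"
        unfolding real_norm_def abs_divide using bound[of h] h by (intro divide_right_mono) auto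
      also have "\<dots> = \<bar>h\<bar> * C"
        using h by (simp add: power2_eq_square field_simps abs_if)
      finally show "norm ((laplace_moment es (x(e := ?a + h)) - laplace_moment es x) / h - - laplace_moment (e # es) x) \<le> \<bar>h\<bar> * C" .
    qed
    show "((\<lambda>h. \<bar>h\<bar> * C) \<longlongrightarrow> 0) (at 0)"
      by (auto intro!: tendsto_eq_intros)
  qed
  then show ?thesis
    unfolding DERIV_def using LIM_zero_iff by fastforce
qed

lemma continuous_on_laplace_moment:
  assumes es: "es \<in> lists E"
  shows "continuous_on {x. \<forall>e\<in>E. 0 < x e} (laplace_moment es)"
  unfolding continuous_on_def
proof (intro ballI)
  let ?S = "{x :: 'e \<Rightarrow> real. \<forall>e\<in>E. 0 < x e}"
  fix x assume "x \<in> ?S"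
  then have x: "\<forall>e\<in>E. 0 < x e" by simp
  \<comment> \<open>The halved point lies below \<open>x\<close> and below every nearby
    \<open>y\<close> in each coordinate from \<open>E\<close>, so its moments give a bound uniform
    near \<open>x\<close>.\<close>
  let ?x = "\<lambda>e. x e / 2"
  have coord: "((\<lambda>y. y e) \<longlongrightarrow> x e) (at x within ?S)" for e
    using continuous_on_subset[OF continuous_on_product_coordinates, of ?S e] \<open>x \<in> ?S\<close>
    by (auto simp: continuous_on_def)
  have "\<forall>\<^sub>F y in at x within ?S. \<forall>e\<in>E. ?x e < y e"
    using x coord by (intro eventually_ball_finite[OF fin] ballI order_tendstoD(1)) auto
  then have ev: "\<forall>\<^sub>F y in at x within ?S.
      norm (laplace_moment es y - laplace_moment es x) \<le> (\<Sum>e\<in>E. \<bar>y e - x e\<bar> * laplace_moment (e # es) ?x)"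
  proof eventually_elim
    case (elim y)
    let ?F = "\<lambda>es x t. prod_list (map t es) * exp (- (\<Sum>e\<in>E. x e * t e))"
    have pos: "\<forall>i\<in>E. 0 < y i" "\<forall>i\<in>E. 0 < ?x i"
      using x elim by (fastforce intro: less_trans[of 0 "x _ / 2"])+
    have I: "integrable M (?F es y)" "integrable M (?F es x)" "\<And>e. e \<in> E \<Longrightarrow> integrable M (?F (e # es) ?x)"
      using integrable_moment[OF _ pos(1)] integrable_moment[OF _ pos(2)] integrable_moment[OF _ x] es
      by (auto simp del: list.map prod_list.Cons)
    have diff: "laplace_moment es y - laplace_moment es x = (\<integral>t. ?F es y t - ?F es x t \<partial>M)"
      unfolding laplace_moment_def using I by simp
    have "\<bar>\<integral>t. ?F es y t - ?F es x t \<partial>M\<bar> \<le> (\<integral>t. (\<Sum>e\<in>E. \<bar>y e - x e\<bar> * ?F (e # es) ?x t) \<partial>M)"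
    proof (rule abs_lebesgue_integral_le)
      fix t assume t: "t \<in> space M"
      have le: "(\<Sum>e\<in>E. ?x e * t e) \<le> (\<Sum>e\<in>E. y e * t e)" "(\<Sum>e\<in>E. ?x e * t e) \<le> (\<Sum>e\<in>E. x e * t e)"
        using elim x nonneg[OF t] by (intro sum_mono mult_right_mono; force)+
      have "\<bar>?F es y t - ?F es x t\<bar> = prod_list (map t es) *
          \<bar>exp (- (\<Sum>e\<in>E. y e * t e)) - exp (- (\<Sum>e\<in>E. x e * t e))\<bar>"
        using prod_list_nonneg[OF t es] by (simp add: abs_mult flip: right_diff_distrib)
      also have "\<dots> \<le> prod_list (map t es) *
          (\<bar>(\<Sum>e\<in>E. y e * t e) - (\<Sum>e\<in>E. x e * t e)\<bar> * exp (- (\<Sum>e\<in>E. ?x e * t e)))"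
        using prod_list_nonneg[OF t es] le by (intro mult_left_mono exp_diff_le)
      also have "(\<Sum>e\<in>E. y e * t e) - (\<Sum>e\<in>E. x e * t e) = (\<Sum>e\<in>E. (y e - x e) * t e)"
        by (simp add: sum_subtractf left_diff_distrib)
      also have "prod_list (map t es) * (\<bar>\<Sum>e\<in>E. (y e - x e) * t e\<bar> * exp (- (\<Sum>e\<in>E. ?x e * t e))) \<le>
          prod_list (map t es) * ((\<Sum>e\<in>E. \<bar>y e - x e\<bar> * t e) * exp (- (\<Sum>e\<in>E. ?x e * t e)))"
        using nonneg[OF t] prod_list_nonneg[OF t es]
        by (intro mult_left_mono mult_right_mono order_trans[OF sum_abs] sum_mono) (auto simp: abs_mult)
      also have "\<dots> = (\<Sum>e\<in>E. \<bar>y e - x e\<bar> * ?F (e # es) ?x t)"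
        by (simp add: sum_distrib_left sum_distrib_right mult_ac)
      finally show "\<bar>?F es y t - ?F es x t\<bar> \<le> (\<Sum>e\<in>E. \<bar>y e - x e\<bar> * ?F (e # es) ?x t)" .
    qed (use I in \<open>auto intro!: Bochner_Integration.integrable_sum integrable_mult_right simp del: list.map prod_list.Cons\<close>)
    also have "\<dots> = (\<Sum>e\<in>E. \<bar>y e - x e\<bar> * laplace_moment (e # es) ?x)"
      unfolding laplace_moment_def using I(3)
      by (subst Bochner_Integration.integral_sum) (auto simp del: list.map prod_list.Cons)
    finally show ?case unfolding real_norm_def diff .
  qed
  have "((\<lambda>y. \<Sum>e\<in>E. \<bar>y e - x e\<bar> * laplace_moment (e # es) ?x) \<longlongrightarrow>
      (\<Sum>e\<in>E. \<bar>x e - x e\<bar> * laplace_moment (e # es) ?x)) (at x within ?S)"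
    by (intro tendsto_intros coord)
  then have "((\<lambda>y. laplace_moment es y - laplace_moment es x) \<longlongrightarrow> 0) (at x within ?S)"
    by (intro Lim_null_comparison[OF ev]) simp
  then show "(laplace_moment es \<longlongrightarrow> laplace_moment es x) (at x within ?S)"
    by (rule LIM_zero_cancel)
qed

lemma completely_monotone_laplace:
  assumes f: "\<And>x. x \<in> pos_orthant E \<Longrightarrow> f x = (\<integral>t. exp (- (\<Sum>e\<in>E. x e * t e)) \<partial>M)"
  shows "completely_monotone E f"
proof -
  have pos: "\<forall>e\<in>E. 0 < x e" if "x \<in> pos_orthant E" for x
    using that by (auto simp: pos_orthant_def)
  \<comment> \<open>\<open>f\<close> is prescribed only on the orthant, so derivatives are taken
    from an equality valid near \<open>x e\<close>; changing a coordinate in \<open>E\<close> keeps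
    the function extensional.\<close>
  have ev: "\<forall>\<^sub>F s in nhds (x e). x(e := s) \<in> pos_orthant E" if "x \<in> pos_orthant E" "e \<in> E" for x e
  proof -
    have "\<forall>\<^sub>F s in nhds (x e). 0 < s"
      using pos that by (intro order_tendstoD(1)[OF filterlim_ident]) auto
    then show ?thesis
      by eventually_elim (use that in \<open>auto simp: pos_orthant_def PiE_def Pi_def extensional_def\<close>)
  qed
  have step: "((\<lambda>s. g (x(e := s))) has_real_derivative (-1) ^ length (e # es) * laplace_moment (e # es) x) (at (x e))"
    if "\<And>y. y \<in> pos_orthant E \<Longrightarrow> g y = (-1) ^ length es * laplace_moment es y"
      "es \<in> lists E" "e \<in> E" "x \<in> pos_orthant E" for g es e x
  proof -
    have "\<forall>\<^sub>F s in nhds (x e). g (x(e := s)) = (-1) ^ length es * laplace_moment es (x(e := s))"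
      using ev[OF that(4,3)] by eventually_elim (use that(1) in auto)
    moreover have "((\<lambda>s. (-1) ^ length es * laplace_moment es (x(e := s))) has_real_derivative
        (-1) ^ length (e # es) * laplace_moment (e # es) x) (at (x e))"
      using DERIV_cmult[OF has_derivative_laplace_moment[OF that(2,3) pos[OF that(4)]], of "(-1) ^ length es"]
      by simp
    ultimately show ?thesis
      by (subst DERIV_cong_ev[OF refl _ refl])
  qed
  have main: "partial_derivs es f x = (-1) ^ length es * laplace_moment es x"
    if "es \<in> lists E" "x \<in> pos_orthant E" for es x
    using that
  proof (induction es arbitrary: x rule: list.induct)
    case Nil
    then show ?case by (simp add: f laplace_moment_def)
  next
    case (Cons e es)
    then show ?case
      using step[of "partial_derivs es f" es e x]
      by (simp add: partial_deriv_def DERIV_imp_deriv del: length_Cons power_Suc)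
  qed
  have "continuous_on (pos_orthant E) (partial_derivs es f)" if "es \<in> lists E" for es
  proof -
    have "continuous_on (pos_orthant E) (\<lambda>x. (-1) ^ length es * laplace_moment es x)"
      using continuous_on_subset[OF continuous_on_laplace_moment[OF that]] pos
      by (intro continuous_intros) auto
    then show ?thesis
      using main[OF that] by (subst continuous_on_cong[OF refl]) auto
  qed
  moreover have "(\<lambda>s. partial_derivs es f (x(e := s))) differentiable (at (x e))"
    if "es \<in> lists E" "e \<in> E" "x \<in> pos_orthant E" for es e x
    using step[of "partial_derivs es f", OF main that] that unfolding real_differentiable_def by blast
  moreover have "0 \<le> (-1) ^ length es * partial_derivs es f x" if "es \<in> lists E" "x \<in> pos_orthant E" for es x
    using main[OF that] laplace_moment_nonneg[OF that(1), of x]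
    by (simp add: mult.assoc[symmetric] flip: power_add)
  ultimately show ?thesis
    unfolding completely_monotone_def smooth_on_orthant_def by blast
qed

end

section \<open>The Gaussian integral over the position of a new vertex\<close>

lemma nn_integral_gaussian:
  fixes s \<mu> :: real
  assumes "0 < s"
  shows "(\<integral>\<^sup>+u. ennreal (exp (- (s * (u - \<mu>)\<^sup>2))) \<partial>lborel) = ennreal (sqrt (pi / s))"
proof -
  define \<sigma> where "\<sigma> = sqrt (1 / (2 * s))"
  have \<sigma>: "0 < \<sigma>" "\<sigma>\<^sup>2 = 1 / (2 * s)" using assms by (auto simp: \<sigma>_def)
  have "exp (- (s * (u - \<mu>)\<^sup>2)) = sqrt (pi / s) * normal_density \<mu> \<sigma> u" for u
    using assms unfolding normal_density_def \<sigma>(2)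
    by (simp add: real_sqrt_divide field_simps)
  then have "(\<integral>\<^sup>+u. ennreal (exp (- (s * (u - \<mu>)\<^sup>2))) \<partial>lborel) =
      (\<integral>\<^sup>+u. ennreal (sqrt (pi / s)) * ennreal (normal_density \<mu> \<sigma> u) \<partial>lborel)"
    using assms by (simp add: ennreal_mult)
  also have "\<dots> = ennreal (sqrt (pi / s)) * ennreal (\<integral>u. normal_density \<mu> \<sigma> u \<partial>lborel)"
    using \<sigma> by (simp add: nn_integral_cmult nn_integral_eq_integral)
  finally show ?thesis using \<sigma> by simp
qed

text \<open>Euler's integral after rescaling by \<open>s\<close>. The absolute value changes nothing
  on the support and matches \<open>cone_lengths\<close>.\<close>

lemma nn_integral_gamma:
  fixes s \<beta> :: real
  assumes "0 < s" "0 < \<beta>"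
  shows "(\<integral>\<^sup>+\<rho>. ennreal (indicator {0..} \<rho> * (\<rho> powr (\<beta> - 1)) * exp (- (s * \<bar>\<rho>\<bar>))) \<partial>lborel) =
    ennreal (Gamma \<beta> * s powr (- \<beta>))"
proof -
  let ?f = "\<lambda>s \<rho>. indicator {0..} \<rho> * (\<rho> powr (\<beta> - 1)) * exp (- (s * \<bar>\<rho>\<bar>)) :: real"
  have 1: "(\<integral>\<^sup>+\<rho>. ennreal (?f 1 \<rho>) \<partial>lborel) = ennreal (Gamma \<beta>)"
  proof -
    have "(\<integral>\<^sup>+\<rho>. ennreal (?f 1 \<rho>) \<partial>lborel) =
        (\<integral>\<^sup>+\<rho>. ennreal (\<rho> powr (\<beta> - 1) / exp \<rho>) * indicator {0..} \<rho> \<partial>lborel)"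
      by (intro nn_integral_cong) (auto simp: indicator_def exp_minus field_simps)
    also have "\<dots> = ennreal (Gamma \<beta>)"
      by (rule nn_integral_has_integral_lebesgue'[OF _ Gamma_integral_real[OF assms(2)]]) auto
    finally show ?thesis .
  qed
  have "(\<integral>\<^sup>+\<rho>. ennreal (?f 1 \<rho>) \<partial>lborel) = ennreal \<bar>s\<bar> * (\<integral>\<^sup>+\<rho>. ennreal (?f 1 (0 + s * \<rho>)) \<partial>lborel)"
    using assms by (intro nn_integral_real_affine) auto
  also have "(\<integral>\<^sup>+\<rho>. ennreal (?f 1 (0 + s * \<rho>)) \<partial>lborel) =
      (\<integral>\<^sup>+\<rho>. ennreal (s powr (\<beta> - 1)) * ennreal (?f s \<rho>) \<partial>lborel)"
    using assms by (intro nn_integral_cong)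
      (auto simp: indicator_def abs_mult powr_mult zero_le_mult_iff mult_ac simp flip: ennreal_mult)
  also have "\<dots> = ennreal (s powr (\<beta> - 1)) * (\<integral>\<^sup>+\<rho>. ennreal (?f s \<rho>) \<partial>lborel)"
    by (rule nn_integral_cmult) simp
  also have "ennreal \<bar>s\<bar> * \<dots> = ennreal (s powr \<beta>) * (\<integral>\<^sup>+\<rho>. ennreal (?f s \<rho>) \<partial>lborel)"
    using assms by (simp add: mult.assoc[symmetric] powr_diff flip: ennreal_mult)
  finally have eq: "ennreal (s powr \<beta>) * (\<integral>\<^sup>+\<rho>. ennreal (?f s \<rho>) \<partial>lborel) = ennreal (Gamma \<beta>)"
    using 1 by simp
  have "(\<integral>\<^sup>+\<rho>. ennreal (?f s \<rho>) \<partial>lborel) =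
      ennreal (s powr (- \<beta>)) * (ennreal (s powr \<beta>) * (\<integral>\<^sup>+\<rho>. ennreal (?f s \<rho>) \<partial>lborel))"
    using assms by (simp add: mult.assoc[symmetric] flip: ennreal_mult powr_add)
  also have "\<dots> = ennreal (Gamma \<beta> * s powr (- \<beta>))"
    unfolding eq using Gamma_real_pos[OF assms(2)] by (simp add: mult.commute flip: ennreal_mult)
  finally show ?thesis .
qed

text \<open>Measurability is checked componentwise in the product sigma-algebra and transferred to
  the Borel sets of triples.\<close>

lemma borel_measurable_triple:
  fixes f :: "real \<times> real \<times> real \<Rightarrow> ennreal"
  assumes "f \<in> borel_measurable (borel \<Otimes>\<^sub>M (borel \<Otimes>\<^sub>M borel))"
  shows "f \<in> borel_measurable lborel"
  using assms by (simp add: borel_prod)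

lemma nn_integral_lborel_prod3:
  fixes f g h :: "real \<Rightarrow> ennreal"
  assumes [measurable]: "f \<in> borel_measurable borel" "g \<in> borel_measurable borel" "h \<in> borel_measurable borel"
  shows "(\<integral>\<^sup>+(a, b, c). f a * (g b * h c) \<partial>lborel) =
    (\<integral>\<^sup>+a. f a \<partial>lborel) * ((\<integral>\<^sup>+b. g b \<partial>lborel) * (\<integral>\<^sup>+c. h c \<partial>lborel))"
proof -
  have 2: "(\<integral>\<^sup>+(b, c). g b * h c \<partial>lborel) = (\<integral>\<^sup>+b. g b \<partial>lborel) * (\<integral>\<^sup>+c. h c \<partial>lborel)"
    unfolding lborel_prod[symmetric]
    by (subst lborel.nn_integral_fst[symmetric]) (auto simp: nn_integral_cmult nn_integral_multc)
  have "(\<lambda>(b, c). g b * h c) \<in> borel_measurable (lborel \<Otimes>\<^sub>M lborel)" by measurable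
  note [measurable] = this[unfolded lborel_prod measurable_lborel1]
  have [measurable]: "(\<lambda>(a, b, c). f a * (g b * h c)) \<in> borel_measurable (lborel \<Otimes>\<^sub>M lborel)"
    unfolding lborel_prod by (rule borel_measurable_triple) measurable
  have "(\<integral>\<^sup>+(a, b, c). f a * (g b * h c) \<partial>lborel) =
      (\<integral>\<^sup>+p. (case p of (a, b, c) \<Rightarrow> f a * (g b * h c)) \<partial>(lborel \<Otimes>\<^sub>M lborel))"
    unfolding lborel_prod ..
  also have "\<dots> = (\<integral>\<^sup>+a. (\<integral>\<^sup>+q. f a * (case q of (b, c) \<Rightarrow> g b * h c) \<partial>lborel) \<partial>lborel)"
    by (subst lborel.nn_integral_fst[symmetric]) (auto simp: case_prod_beta)
  also have "\<dots> = (\<integral>\<^sup>+a. f a \<partial>lborel) * ((\<integral>\<^sup>+b. g b \<partial>lborel) * (\<integral>\<^sup>+c. h c \<partial>lborel))"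
    by (subst nn_integral_cmult) (auto simp: 2 nn_integral_multc)
  finally show ?thesis .
qed

text \<open>For half-integers \<open>\<beta>\<close>, \<open>\<rho>\<close> stands for the squared distance of a point of
  \<open>\<real>\<^bsup>2\<beta>\<^esup>\<close> from the plane spanned by the first two coordinates.\<close>

definition radial_measure :: "real \<Rightarrow> (real \<times> real \<times> real) measure" where
  "radial_measure \<beta> = density lborel
     (\<lambda>(u, v, \<rho>). ennreal (indicator {0..} \<rho> * \<rho> powr (\<beta> - 2) / (pi * Gamma (\<beta> - 1))))"

lemma sets_radial_measure [measurable_cong]: "sets (radial_measure \<beta>) = sets borel"
  by (simp add: radial_measure_def)

lemma sigma_finite_radial_measure: "sigma_finite_measure (radial_measure \<beta>)"
  unfolding radial_measure_def
  by (subst sigma_finite_measure.sigma_finite_iff_density_finite[OF lborel.sigma_finite_measure_axioms],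
      rule borel_measurable_triple) (auto simp: case_prod_beta)

text \<open>Completing the square about the weighted mean, as in the parallel axis theorem. The
  remainder carries exactly the mesh weights \<open>x * y / s\<close>, \<open>y * z / s\<close>,
  \<open>x * z / s\<close>.\<close>

lemma sum_of_squares_centre:
  fixes x y z a b c u :: real
  assumes "x + y + z \<noteq> 0"
  shows "x * (u - a)\<^sup>2 + y * (u - b)\<^sup>2 + z * (u - c)\<^sup>2 =
    (x + y + z) * (u - (x * a + y * b + z * c) / (x + y + z))\<^sup>2 +
    (x * y * (a - b)\<^sup>2 + y * z * (b - c)\<^sup>2 + x * z * (a - c)\<^sup>2) / (x + y + z)"
proof -
  define s \<mu> where "s = x + y + z" and "\<mu> = (x * a + y * b + z * c) / s"
  have s: "s \<noteq> 0" and \<mu>: "s * \<mu> = x * a + y * b + z * c" using assms by (auto simp: s_def \<mu>_def)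
  have "s * (x * (u - a)\<^sup>2 + y * (u - b)\<^sup>2 + z * (u - c)\<^sup>2) =
      (s * u - s * \<mu>)\<^sup>2 + (x * y * (a - b)\<^sup>2 + y * z * (b - c)\<^sup>2 + x * z * (a - c)\<^sup>2)"
    unfolding \<mu> unfolding s_def by algebra
  also have "(s * u - s * \<mu>)\<^sup>2 = s * (s * (u - \<mu>)\<^sup>2)" by algebra
  finally have "x * (u - a)\<^sup>2 + y * (u - b)\<^sup>2 + z * (u - c)\<^sup>2 =
      s * (u - \<mu>)\<^sup>2 + (x * y * (a - b)\<^sup>2 + y * z * (b - c)\<^sup>2 + x * z * (a - c)\<^sup>2) / s"
    using s by (simp add: field_simps)
  then show ?thesis unfolding s_def \<mu>_def .
qed

text \<open>After completing the square in both coordinates, the integrand factors into two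
  Gaussians, each giving \<open>sqrt (pi / s)\<close>, and a Gamma integral giving
  \<open>Gamma (\<beta> - 1) * s powr (1 - \<beta>)\<close>. This is the origin of the constant in
  \<open>radial_measure\<close>: it leaves exactly \<open>s powr (- \<beta>)\<close>.\<close>

lemma nn_integral_star:
  fixes x y z \<beta> :: real and a b c :: "real \<times> real"
  assumes s: "s = x + y + z" "0 < s" and \<beta>: "1 < \<beta>"
    and dist: "dab = (fst a - fst b)\<^sup>2 + (snd a - snd b)\<^sup>2"
      "dbc = (fst b - fst c)\<^sup>2 + (snd b - snd c)\<^sup>2"
      "dac = (fst a - fst c)\<^sup>2 + (snd a - snd c)\<^sup>2"
  shows "(\<integral>\<^sup>+(u, v, \<rho>). ennreal (exp (- (x * ((u - fst a)\<^sup>2 + (v - snd a)\<^sup>2 + \<bar>\<rho>\<bar>) +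
      y * ((u - fst b)\<^sup>2 + (v - snd b)\<^sup>2 + \<bar>\<rho>\<bar>) + z * ((u - fst c)\<^sup>2 + (v - snd c)\<^sup>2 + \<bar>\<rho>\<bar>))))
        \<partial>radial_measure \<beta>) =
    ennreal (s powr (- \<beta>) * exp (- ((x * y * dab + y * z * dbc + x * z * dac) / s)))"
proof -
  define m n where "m = (x * fst a + y * fst b + z * fst c) / s"
    and "n = (x * snd a + y * snd b + z * snd c) / s"
  define d where "d = (x * y * dab + y * z * dbc + x * z * dac) / s"
  let ?G = "pi * Gamma (\<beta> - 1)"
  have G: "0 < ?G" using \<beta> by (simp add: Gamma_real_pos)
  have s0: "x + y + z \<noteq> 0" using s by simp
  have quad: "x * ((u - fst a)\<^sup>2 + (v - snd a)\<^sup>2 + r) + y * ((u - fst b)\<^sup>2 + (v - snd b)\<^sup>2 + r) +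
      z * ((u - fst c)\<^sup>2 + (v - snd c)\<^sup>2 + r) = s * (u - m)\<^sup>2 + s * (v - n)\<^sup>2 + s * r + d" for u v r
  proof -
    have "x * ((u - fst a)\<^sup>2 + (v - snd a)\<^sup>2 + r) + y * ((u - fst b)\<^sup>2 + (v - snd b)\<^sup>2 + r) +
        z * ((u - fst c)\<^sup>2 + (v - snd c)\<^sup>2 + r) =
        (x * (u - fst a)\<^sup>2 + y * (u - fst b)\<^sup>2 + z * (u - fst c)\<^sup>2) +
        (x * (v - snd a)\<^sup>2 + y * (v - snd b)\<^sup>2 + z * (v - snd c)\<^sup>2) + s * r"
      unfolding s(1) by algebra
    also have "\<dots> = s * (u - m)\<^sup>2 + s * (v - n)\<^sup>2 + s * r + d"
      unfolding sum_of_squares_centre[OF s0, folded s(1)] m_def n_def d_def dist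
      by (simp add: add_divide_distrib distrib_left)
    finally show ?thesis .
  qed
  let ?h = "\<lambda>\<rho>. indicator {0..} \<rho> * \<rho> powr (\<beta> - 1 - 1) * exp (- (s * \<bar>\<rho>\<bar>)) :: real"
  have "(\<integral>\<^sup>+(u, v, \<rho>). ennreal (exp (- (x * ((u - fst a)\<^sup>2 + (v - snd a)\<^sup>2 + \<bar>\<rho>\<bar>) +
      y * ((u - fst b)\<^sup>2 + (v - snd b)\<^sup>2 + \<bar>\<rho>\<bar>) + z * ((u - fst c)\<^sup>2 + (v - snd c)\<^sup>2 + \<bar>\<rho>\<bar>))))
        \<partial>radial_measure \<beta>) =
      (\<integral>\<^sup>+(u, v, \<rho>). ennreal (exp (- (s * (u - m)\<^sup>2))) *
        (ennreal (exp (- (s * (v - n)\<^sup>2))) * (ennreal (exp (- d) / ?G) * ennreal (?h \<rho>))) \<partial>lborel)"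
    unfolding quad radial_measure_def
  proof (subst nn_integral_density)
    show "(\<lambda>(u :: real, v :: real, \<rho>). ennreal (indicator {0..} \<rho> * \<rho> powr (\<beta> - 2) / ?G)) \<in> borel_measurable lborel"
      by (rule borel_measurable_triple) measurable
    show "(\<lambda>(u, v, \<rho>). ennreal (exp (- (s * (u - m)\<^sup>2 + s * (v - n)\<^sup>2 + s * \<bar>\<rho>\<bar> + d)))) \<in> borel_measurable lborel"
      by (rule borel_measurable_triple) measurable
    have "indicator {0..} \<rho> * \<rho> powr (\<beta> - 2) / ?G * exp (- (s * (u - m)\<^sup>2 + s * (v - n)\<^sup>2 + s * \<bar>\<rho>\<bar> + d)) =
        exp (- (s * (u - m)\<^sup>2)) * (exp (- (s * (v - n)\<^sup>2)) * (exp (- d) / ?G * ?h \<rho>))" for u v \<rho>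
      unfolding minus_add_distrib exp_add by simp
    then show "(\<integral>\<^sup>+p. (case p of (u, v, \<rho>) \<Rightarrow> ennreal (indicator {0..} \<rho> * \<rho> powr (\<beta> - 2) / ?G)) *
        (case p of (u, v, \<rho>) \<Rightarrow> ennreal (exp (- (s * (u - m)\<^sup>2 + s * (v - n)\<^sup>2 + s * \<bar>\<rho>\<bar> + d)))) \<partial>lborel) =
      (\<integral>\<^sup>+(u, v, \<rho>). ennreal (exp (- (s * (u - m)\<^sup>2))) *
        (ennreal (exp (- (s * (v - n)\<^sup>2))) * (ennreal (exp (- d) / ?G) * ennreal (?h \<rho>))) \<partial>lborel)"
      using G by (intro nn_integral_cong) (simp add: case_prod_beta flip: ennreal_mult)
  qed
  also have "\<dots> = (\<integral>\<^sup>+u. ennreal (exp (- (s * (u - m)\<^sup>2))) \<partial>lborel) *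
      ((\<integral>\<^sup>+v. ennreal (exp (- (s * (v - n)\<^sup>2))) \<partial>lborel) *
      (\<integral>\<^sup>+\<rho>. ennreal (exp (- d) / ?G) * ennreal (?h \<rho>) \<partial>lborel))"
    by (rule nn_integral_lborel_prod3) auto
  also have "(\<integral>\<^sup>+\<rho>. ennreal (exp (- d) / ?G) * ennreal (?h \<rho>) \<partial>lborel) =
      ennreal (exp (- d) / ?G) * ennreal (Gamma (\<beta> - 1) * s powr (- (\<beta> - 1)))"
    by (subst nn_integral_cmult, simp, subst nn_integral_gamma) (use \<beta> s in auto)
  also have "(\<integral>\<^sup>+u. ennreal (exp (- (s * (u - m)\<^sup>2))) \<partial>lborel) *
      ((\<integral>\<^sup>+v. ennreal (exp (- (s * (v - n)\<^sup>2))) \<partial>lborel) * \<dots>) =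
      ennreal (sqrt (pi / s) * (sqrt (pi / s) * (exp (- d) / ?G * (Gamma (\<beta> - 1) * s powr (- (\<beta> - 1))))))"
    unfolding nn_integral_gaussian[OF s(2)] using G s \<beta>
    by (simp add: Gamma_real_pos less_imp_le flip: ennreal_mult)
  also have "sqrt (pi / s) * (sqrt (pi / s) * (exp (- d) / ?G * (Gamma (\<beta> - 1) * s powr (- (\<beta> - 1))))) =
      s powr (- \<beta>) * exp (- d)"
  proof -
    have sq: "sqrt (pi / s) * sqrt (pi / s) = pi / s" using s(2) by simp
    have sp: "s powr (- (\<beta> - 1)) = s powr (- \<beta>) * s"
      using s(2) by (simp add: powr_minus powr_diff field_simps)
    have "sqrt (pi / s) * (sqrt (pi / s) * (exp (- d) / ?G * (Gamma (\<beta> - 1) * s powr (- (\<beta> - 1))))) =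
        pi / s * (exp (- d) / ?G * (Gamma (\<beta> - 1) * (s powr (- \<beta>) * s)))"
      unfolding mult.assoc[symmetric, of "sqrt (pi / s)" "sqrt (pi / s)"] sq sp ..
    also have "\<dots> = s powr (- \<beta>) * exp (- d)"
      using s(2) zero_less_mult_pos[OF G pi_gt_zero] by (simp add: field_simps)
    finally show ?thesis .
  qed
  finally show ?thesis unfolding d_def .
qed

section \<open>Representing measures for stacked graphs\<close>

text \<open>The vertices \<open>a, b, c\<close> need not be distinct, so that cliques of one and two vertices are
  covered as well.\<close>

inductive stacked :: "'v set \<Rightarrow> 'v set set \<Rightarrow> bool" where
  single: "stacked {v} {}"
| stack: "stacked V E \<Longrightarrow> n \<notin> V \<Longrightarrow> {a, b, c} \<subseteq> V \<Longrightarrow>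
    (a \<noteq> b \<longrightarrow> {a, b} \<in> E) \<Longrightarrow> (b \<noteq> c \<longrightarrow> {b, c} \<in> E) \<Longrightarrow> (a \<noteq> c \<longrightarrow> {a, c} \<in> E) \<Longrightarrow>
    stacked (insert n V) (E \<union> {{n, a}, {n, b}, {n, c}})"

lemma stacked_simple: "stacked V E \<Longrightarrow> simple_graph V E"
proof (induction rule: stacked.induct)
  case (stack V E n a b c)
  then show ?case by (auto simp: simple_graph_def card_insert_if)
qed (simp add: simple_graph_def)

section \<open>Squared lengths and the planar placement of a triangle\<close>

definition sqdist :: "('v set \<Rightarrow> real) \<Rightarrow> 'v \<Rightarrow> 'v \<Rightarrow> real" where
  "sqdist t i j = (if i = j then 0 else t {i, j})"

lemma sqdist_commute: "sqdist t i j = sqdist t j i"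
  by (simp add: sqdist_def insert_commute)

text \<open>By Heron's formula, nonnegative \<open>\<alpha>, \<beta>, \<gamma>\<close> are the squared side lengths of a
  triangle in the Euclidean plane iff this holds.\<close>

definition heron :: "real \<Rightarrow> real \<Rightarrow> real \<Rightarrow> bool" where
  "heron \<alpha> \<beta> \<gamma> \<longleftrightarrow> \<alpha>\<^sup>2 + \<beta>\<^sup>2 + \<gamma>\<^sup>2 \<le> 2 * \<alpha> * \<beta> + 2 * \<beta> * \<gamma> + 2 * \<alpha> * \<gamma>"

lemma heron_swap: "heron \<alpha> \<beta> \<gamma> \<Longrightarrow> heron \<beta> \<alpha> \<gamma>" "heron \<alpha> \<beta> \<gamma> \<Longrightarrow> heron \<alpha> \<gamma> \<beta>"
  by (auto simp: heron_def algebra_simps)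

lemma heron_degenerate: "heron 0 \<alpha> \<alpha>" "heron \<alpha> 0 \<alpha>" "heron \<alpha> \<alpha> 0"
  by (auto simp: heron_def power2_eq_square)

lemma heron_apex:
  fixes u v r p1 p2 q1 q2 :: real
  assumes "0 \<le> r"
  shows "heron ((u - p1)\<^sup>2 + (v - p2)\<^sup>2 + r) ((u - q1)\<^sup>2 + (v - q2)\<^sup>2 + r) ((p1 - q1)\<^sup>2 + (p2 - q2)\<^sup>2)"
proof -
  \<comment> \<open>Sixteen times the squared area of the triangle with its apex at height
    \<open>sqrt r\<close>, read off from the cross product of the two sides at the apex.\<close>
  have "0 \<le> 4 * (((u - p1) * (v - q2) - (v - p2) * (u - q1))\<^sup>2 + r * ((p1 - q1)\<^sup>2 + (p2 - q2)\<^sup>2))"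
    using assms by simp
  also have "\<dots> = 2 * ((u - p1)\<^sup>2 + (v - p2)\<^sup>2 + r) * ((u - q1)\<^sup>2 + (v - q2)\<^sup>2 + r) +
      2 * ((u - q1)\<^sup>2 + (v - q2)\<^sup>2 + r) * ((p1 - q1)\<^sup>2 + (p2 - q2)\<^sup>2) +
      2 * ((u - p1)\<^sup>2 + (v - p2)\<^sup>2 + r) * ((p1 - q1)\<^sup>2 + (p2 - q2)\<^sup>2) -
      (((u - p1)\<^sup>2 + (v - p2)\<^sup>2 + r)\<^sup>2 + ((u - q1)\<^sup>2 + (v - q2)\<^sup>2 + r)\<^sup>2 + ((p1 - q1)\<^sup>2 + (p2 - q2)\<^sup>2)\<^sup>2)"
    by algebra
  finally show ?thesis unfolding heron_def by linarith
qed

definition euclidean_triangles :: "'v set set \<Rightarrow> ('v set \<Rightarrow> real) \<Rightarrow> bool" where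
  "euclidean_triangles E t \<longleftrightarrow> (\<forall>e\<in>E. 0 \<le> t e) \<and>
     (\<forall>i j k. (i = j \<or> {i, j} \<in> E) \<longrightarrow> (j = k \<or> {j, k} \<in> E) \<longrightarrow> (i = k \<or> {i, k} \<in> E) \<longrightarrow>
        heron (sqdist t i j) (sqdist t i k) (sqdist t j k))"

text \<open>The coordinates of \<open>c\<close> when \<open>a\<close> is the origin and \<open>b\<close> lies on the first axis.  If
  \<open>dab = 0\<close>, division by zero makes the first coordinate 0, which is a correct placement.\<close>

definition vertex_c :: "real \<Rightarrow> real \<Rightarrow> real \<Rightarrow> real \<times> real" where
  "vertex_c dab dac dbc = (let p = (dab + dac - dbc) / (2 * sqrt dab) in (p, sqrt (dac - p\<^sup>2)))"

text \<open>The placement is an explicit formula rather than a choice of points, so that it depends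
  measurably on \<open>t\<close>.\<close>

definition vertex :: "('v set \<Rightarrow> real) \<Rightarrow> 'v \<Rightarrow> 'v \<Rightarrow> 'v \<Rightarrow> 'v \<Rightarrow> real \<times> real" where
  "vertex t a b c k =
     (if k = a then (0, 0) else if k = b then (sqrt (sqdist t a b), 0)
      else vertex_c (sqdist t a b) (sqdist t a c) (sqdist t b c))"

text \<open>The first coordinate comes from the law of cosines. Heron's condition, rearranged as
  \<open>h\<close>, says that the cosine is at most 1 in absolute value, so the second root is taken
  of a nonnegative number; for \<open>dab = 0\<close> it forces \<open>dac = dbc\<close>.\<close>

lemma vertex_c_dist:
  assumes "0 \<le> dab" "0 \<le> dac" "0 \<le> dbc" "heron dab dac dbc"
  shows "(fst (vertex_c dab dac dbc))\<^sup>2 + (snd (vertex_c dab dac dbc))\<^sup>2 = dac"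
    "(sqrt dab - fst (vertex_c dab dac dbc))\<^sup>2 + (snd (vertex_c dab dac dbc))\<^sup>2 = dbc"
proof -
  define p where "p = (dab + dac - dbc) / (2 * sqrt dab)"
  have h: "(dab + dac - dbc)\<^sup>2 \<le> 4 * dab * dac"
    using assms(4) unfolding heron_def by (simp add: power2_eq_square algebra_simps)
  have p: "p\<^sup>2 \<le> dac" "dab - 2 * sqrt dab * p + dac = dbc"
  proof -
    show "p\<^sup>2 \<le> dac"
    proof (cases "dab = 0")
      case False
      then have "p\<^sup>2 = (dab + dac - dbc)\<^sup>2 / (4 * dab)"
        using assms by (simp add: p_def power_divide power_mult_distrib)
      also have "\<dots> \<le> dac" using h False assms by (simp add: divide_simps mult_ac)
      finally show ?thesis .
    qed (use assms in \<open>simp add: p_def\<close>)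
    show "dab - 2 * sqrt dab * p + dac = dbc"
    proof (cases "dab = 0")
      case True
      then have "(dac - dbc)\<^sup>2 \<le> 0" using h by simp
      then show ?thesis using True by simp
    next
      case False
      then have "2 * sqrt dab * p = dab + dac - dbc"
        using assms by (simp add: p_def)
      then show ?thesis by simp
    qed
  qed
  have v: "vertex_c dab dac dbc = (p, sqrt (dac - p\<^sup>2))"
    by (simp add: vertex_c_def p_def Let_def)
  show "(fst (vertex_c dab dac dbc))\<^sup>2 + (snd (vertex_c dab dac dbc))\<^sup>2 = dac"
    unfolding v using p by simp
  have "(sqrt dab - p)\<^sup>2 + (sqrt (dac - p\<^sup>2))\<^sup>2 = dab - 2 * sqrt dab * p + dac"
    using p(1) assms(1) by (simp add: power2_diff)
  then show "(sqrt dab - fst (vertex_c dab dac dbc))\<^sup>2 + (snd (vertex_c dab dac dbc))\<^sup>2 = dbc"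
    unfolding v p(2) by simp
qed

context
  fixes E :: "'v set set" and t :: "'v set \<Rightarrow> real" and a b c :: 'v
  assumes t: "euclidean_triangles E t"
    and abc: "a \<noteq> b \<longrightarrow> {a, b} \<in> E" "b \<noteq> c \<longrightarrow> {b, c} \<in> E" "a \<noteq> c \<longrightarrow> {a, c} \<in> E"
begin

lemma sqdist_nonneg: "0 \<le> sqdist t a b" "0 \<le> sqdist t a c" "0 \<le> sqdist t b c"
  using t abc by (auto simp: euclidean_triangles_def sqdist_def)

lemma heron_abc: "heron (sqdist t a b) (sqdist t a c) (sqdist t b c)"
proof -
  have "a = b \<or> {a, b} \<in> E" "b = c \<or> {b, c} \<in> E" "a = c \<or> {a, c} \<in> E"
    using abc by auto
  then show ?thesis
    using t[unfolded euclidean_triangles_def, THEN conjunct2, rule_format, of a b c] by blast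
qed

lemma vertex_dist:
  assumes "i \<in> {a, b, c}" "j \<in> {a, b, c}"
  shows "(fst (vertex t a b c i) - fst (vertex t a b c j))\<^sup>2 +
    (snd (vertex t a b c i) - snd (vertex t a b c j))\<^sup>2 = sqdist t i j"
proof -
  let ?d = "\<lambda>P Q :: real \<times> real. (fst P - fst Q)\<^sup>2 + (snd P - snd Q)\<^sup>2"
  let ?C = "vertex_c (sqdist t a b) (sqdist t a c) (sqdist t b c)"
  note C = vertex_c_dist[OF sqdist_nonneg heron_abc]
  have comm: "?d P Q = ?d Q P" for P Q by (simp add: power2_commute)
  have ab: "?d (vertex t a b c a) (vertex t a b c b) = sqdist t a b"
    using sqdist_nonneg by (auto simp: vertex_def sqdist_def)
  have ac: "?d (vertex t a b c a) (vertex t a b c c) = sqdist t a c"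
    using sqdist_nonneg C(1) by (auto simp: vertex_def sqdist_def)
  have bc: "?d (vertex t a b c b) (vertex t a b c c) = sqdist t b c"
  proof (cases "b = a \<or> c = a \<or> c = b")
    case True
    then show ?thesis
      using ab ac comm sqdist_commute[of t] by (auto simp: sqdist_def[of t b b])
  next
    case False
    then show ?thesis
      using C(2) by (simp add: vertex_def)
  qed
  define P where "P i j \<longleftrightarrow> ?d (vertex t a b c i) (vertex t a b c j) = sqdist t i j" for i j
  have "P a b" "P a c" "P b c" using ab ac bc by (auto simp: P_def)
  moreover have "P k k" for k by (simp add: P_def sqdist_def)
  moreover have "P j i" if "P i j" for i j
    using that comm sqdist_commute[of t] unfolding P_def by metis
  ultimately have "P i j" using assms by blast
  then show ?thesis by (simp add: P_def)
qed

end

text \<open>On an edge at \<open>n\<close>, \<open>the_elem\<close> recovers the other end. Using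
  |\<rho>| makes every point of the product space, not just almost every one, yield admissible
  lengths.\<close>

definition cone_lengths :: "'v \<Rightarrow> 'v \<Rightarrow> 'v \<Rightarrow> 'v \<Rightarrow> ('v set \<Rightarrow> real) \<Rightarrow> real \<times> real \<times> real \<Rightarrow> 'v set \<Rightarrow> real" where
  "cone_lengths n a b c t q e =
     (if n \<in> e then
        let P = vertex t a b c (the_elem (e - {n}))
        in (fst q - fst P)\<^sup>2 + (fst (snd q) - snd P)\<^sup>2 + \<bar>snd (snd q)\<bar>
      else t e)"

lemma cone_old: "n \<notin> e \<Longrightarrow> cone_lengths n a b c t q e = t e"
  by (simp add: cone_lengths_def)

lemma cone_new:
  assumes "k \<noteq> n"
  shows "cone_lengths n a b c t (u, v, r) {n, k} =
    (u - fst (vertex t a b c k))\<^sup>2 + (v - snd (vertex t a b c k))\<^sup>2 + \<bar>r\<bar>"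
proof -
  have "{n, k} - {n} = {k}" using assms by auto
  then show ?thesis by (simp add: cone_lengths_def Let_def)
qed

text \<open>In a triangle through \<open>n\<close> the other two vertices belong to
  \<open>a, b, c\<close>, so its lengths are realised by their placed points and an apex over the
  plane. Triangles avoiding \<open>n\<close> are old ones.\<close>

lemma euclidean_triangles_cone:
  assumes G: "simple_graph V E" and t: "euclidean_triangles E t" and n: "n \<notin> V" and V: "{a, b, c} \<subseteq> V"
    and abc: "a \<noteq> b \<longrightarrow> {a, b} \<in> E" "b \<noteq> c \<longrightarrow> {b, c} \<in> E" "a \<noteq> c \<longrightarrow> {a, c} \<in> E"
  shows "euclidean_triangles (E \<union> {{n, a}, {n, b}, {n, c}}) (cone_lengths n a b c t q)"
proof -
  let ?E = "E \<union> {{n, a}, {n, b}, {n, c}}" and ?t = "cone_lengths n a b c t q"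
  obtain u v r where q: "q = (u, v, r)" by (metis prod_cases3)
  have nE: "n \<notin> e" if "e \<in> E" for e
    using that G n by (auto simp: simple_graph_def)
  have old: "i \<noteq> n \<and> j \<noteq> n \<and> sqdist ?t i j = sqdist t i j" if "{i, j} \<in> E" for i j
    using nE[OF that] by (auto simp: sqdist_def cone_old)
  have new: "k \<in> {a, b, c}" if "{n, k} \<in> ?E" for k
    using that nE n V by (auto simp: doubleton_eq_iff)
  have apex: "heron (sqdist ?t n i) (sqdist ?t n j) (sqdist ?t i j)"
    if "{n, i} \<in> ?E" "{n, j} \<in> ?E" for i j
  proof -
    have ij: "i \<in> {a, b, c}" "j \<in> {a, b, c}" using new that by auto
    then have "i \<noteq> n" "j \<noteq> n" using n V by auto
    then have "sqdist ?t i j = sqdist t i j"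
      by (simp add: sqdist_def cone_old)
    also have "\<dots> = (fst (vertex t a b c i) - fst (vertex t a b c j))\<^sup>2 +
        (snd (vertex t a b c i) - snd (vertex t a b c j))\<^sup>2"
      using vertex_dist[OF t abc ij] by simp
    finally have ij_dist: "sqdist ?t i j = (fst (vertex t a b c i) - fst (vertex t a b c j))\<^sup>2 +
        (snd (vertex t a b c i) - snd (vertex t a b c j))\<^sup>2" .
    have "sqdist ?t n k = (u - fst (vertex t a b c k))\<^sup>2 + (v - snd (vertex t a b c k))\<^sup>2 + \<bar>r\<bar>"
      if "k \<noteq> n" for k
      using that by (simp add: sqdist_def q cone_new)
    with \<open>i \<noteq> n\<close> \<open>j \<noteq> n\<close> show ?thesis
      unfolding ij_dist by (simp add: heron_apex)
  qed
  have edge: "{i, j} \<in> E \<or> i = n \<and> j \<in> {a, b, c} \<or> j = n \<and> i \<in> {a, b, c}" if "{i, j} \<in> ?E" for i j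
    using that by (auto simp: doubleton_eq_iff)
  have *: "heron (sqdist ?t i j) (sqdist ?t i k) (sqdist ?t j k)"
    if ij: "{i, j} \<in> ?E" and jk: "{j, k} \<in> ?E" and ik: "{i, k} \<in> ?E" for i j k
  proof -
    consider "i = n" | "j = n" | "k = n" | "i \<noteq> n" "j \<noteq> n" "k \<noteq> n" by blast
    then show ?thesis
    proof cases
      case 1
      then show ?thesis using apex[of j k] ij ik by simp
    next
      case 2
      then have "heron (sqdist ?t n i) (sqdist ?t n k) (sqdist ?t i k)"
        using apex[of i k] ij jk by (simp add: insert_commute)
      from heron_swap(2)[OF this] show ?thesis
        using 2 by (simp add: sqdist_commute[of ?t i n])
    next
      case 3
      then have "heron (sqdist ?t n i) (sqdist ?t n j) (sqdist ?t i j)"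
        using apex[of i j] ik jk by (simp add: insert_commute)
      from heron_swap(1)[OF heron_swap(2)[OF this]] show ?thesis
        using 3 by (simp add: sqdist_commute[of ?t i n] sqdist_commute[of ?t j n])
    next
      case 4
      then have E: "{i, j} \<in> E" "{j, k} \<in> E" "{i, k} \<in> E" using edge[OF ij] edge[OF jk] edge[OF ik] by simp_all
      then have "heron (sqdist t i j) (sqdist t i k) (sqdist t j k)"
        using t[unfolded euclidean_triangles_def, THEN conjunct2, rule_format, of i j k] by simp
      then show ?thesis using E old by simp
    qed
  qed
  have "heron (sqdist ?t i j) (sqdist ?t i k) (sqdist ?t j k)"
    if "i = j \<or> {i, j} \<in> ?E" "j = k \<or> {j, k} \<in> ?E" "i = k \<or> {i, k} \<in> ?E" for i j k
  proof (cases "i = j \<or> j = k \<or> i = k")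
    case True
    have "sqdist ?t x x = 0" for x by (simp add: sqdist_def)
    with True show ?thesis
      by (elim disjE) (simp_all add: heron_degenerate sqdist_commute[of ?t k j])
  next
    case False
    then have "{i, j} \<in> ?E" "{j, k} \<in> ?E" "{i, k} \<in> ?E" using that by simp_all
    then show ?thesis by (rule *)
  qed
  moreover have "0 \<le> ?t e" if "e \<in> ?E" for e
  proof (cases "n \<in> e")
    case True
    then show ?thesis by (simp add: cone_lengths_def Let_def)
  next
    case False
    then have "e \<in> E" using that by auto
    then show ?thesis using t False by (simp add: cone_old euclidean_triangles_def)
  qed
  ultimately show ?thesis unfolding euclidean_triangles_def by (intro conjI ballI allI impI)
qed

section \<open>Integrating out one stacked vertex\<close>

lemma star_weight_pos:
  assumes G: "simple_graph V E" "n \<notin> V" "a \<in> V" "{b, c} \<subseteq> V" and w: "\<forall>e\<in>E \<union> {{n, a}, {n, b}, {n, c}}. 0 \<le> w e"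
    and pos: "0 < spanning_tree_poly (insert n V) (E \<union> {{n, a}, {n, b}, {n, c}}) w"
  shows "w {n, a} \<noteq> 0 \<or> w {n, b} \<noteq> 0 \<or> w {n, c} \<noteq> 0"
proof (rule ccontr)
  assume *: "\<not> ?thesis"
  let ?E = "E \<union> {{n, a}, {n, b}, {n, c}}"
  have "(\<Prod>e\<in>T. w e) = 0" if "T \<in> spanning_trees (insert n V) ?E" for T
  proof -
    have T: "T \<subseteq> ?E" "connected_graph (insert n V) T" "simple_graph (insert n V) T"
      using that by (auto simp: spanning_trees_def tree_graph_def)
    \<comment> \<open>A spanning tree has to leave \<open>n\<close> by some edge, and all edges at
      \<open>n\<close> are assumed to have weight 0.\<close>
    have "(n, a) \<in> {(u, v). {u, v} \<in> T}\<^sup>*" "n \<noteq> a"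
      using T(2) G by (auto simp: connected_graph_def)
    then obtain k where k: "{n, k} \<in> T"
      by (auto elim: converse_rtranclE)
    have "{n, k} \<notin> E" using G by (auto simp: simple_graph_def)
    then have "{n, k} \<in> {{n, a}, {n, b}, {n, c}}" using k T(1) by blast
    then have "w {n, k} = 0" using * by (auto simp: doubleton_eq_iff)
    then show ?thesis
      using k simple_graph_finite_edges[OF T(3)] prod_zero by metis
  qed
  then show False using pos by (simp add: spanning_tree_poly_def)
qed

lemma sum_star:
  fixes f g :: "'v set \<Rightarrow> real"
  assumes G: "simple_graph V E" "n \<notin> V" "{a, b, c} \<subseteq> V"
  shows "(\<Sum>e\<in>E \<union> {{n, a}, {n, b}, {n, c}}. f e) = (\<Sum>e\<in>E. f e) +
    f {n, a} + (if b = a then 0 else f {n, b}) + (if c = a \<or> c = b then 0 else f {n, c})"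
proof -
  have "E \<inter> {{n, a}, {n, b}, {n, c}} = {}"
    using G by (auto simp: simple_graph_def)
  then have "(\<Sum>e\<in>E \<union> {{n, a}, {n, b}, {n, c}}. f e) = (\<Sum>e\<in>E. f e) + (\<Sum>e\<in>{{n, a}, {n, b}, {n, c}}. f e)"
    using simple_graph_finite_edges[OF G(1)] by (intro sum.union_disjoint) auto
  also have "(\<Sum>e\<in>{{n, a}, {n, b}, {n, c}}. f e) =
      f {n, a} + (if b = a then 0 else f {n, b}) + (if c = a \<or> c = b then 0 else f {n, c})"
  proof -
    have "{n, i} = {n, j} \<longleftrightarrow> i = j" for i j :: 'v by (auto simp: doubleton_eq_iff)
    then show ?thesis
      by (cases "b = a"; cases "c = a"; cases "c = b") (simp_all add: sum.insert_if)
  qed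
  finally show ?thesis by simp
qed

lemma sum_delta_edge:
  fixes m :: real
  assumes "simple_graph V E" "a \<noteq> b \<longrightarrow> {a, b} \<in> E"
  shows "(\<Sum>e\<in>E. (if e = {a, b} then m else 0) * t e) = m * sqdist t a b"
proof (cases "a = b")
  case True
  have "{b} \<notin> E" using assms(1) by (force simp: simple_graph_def)
  then show ?thesis
    using True by (auto simp: sqdist_def intro!: sum.neutral)
next
  case False
  have "(\<Sum>e\<in>E. (if e = {a, b} then m else 0) * t e) = (\<Sum>e\<in>E. if e = {a, b} then m * t e else 0)"
    by (intro sum.cong) auto
  then show ?thesis
    using False assms simple_graph_finite_edges[OF assms(1)] by (simp add: sqdist_def)
qed

text \<open>Zero weights are included so that edges can be deleted by substitution; positivity of
  the polynomial then replaces positivity of the weights. The triangle condition holds pointwise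
  because the next vertex is placed separately for each \<open>t\<close>.\<close>

definition laplace_representation ::
  "real \<Rightarrow> 'v set \<Rightarrow> 'v set set \<Rightarrow> ('v set \<Rightarrow> real) measure \<Rightarrow> bool" where
  "laplace_representation \<beta> V E M \<longleftrightarrow>
     (\<forall>t\<in>space M. euclidean_triangles E t) \<and> (\<forall>e. (\<lambda>t. t e) \<in> borel_measurable M) \<and>
     (\<forall>w. (\<forall>e\<in>E. 0 \<le> w e) \<longrightarrow> 0 < spanning_tree_poly V E w \<longrightarrow>
       (\<integral>\<^sup>+t. ennreal (exp (- (\<Sum>e\<in>E. w e * t e))) \<partial>M) = ennreal (spanning_tree_poly V E w powr (- \<beta>)))"

text \<open>The empty tree is the only spanning tree, so the polynomial is 1 and a unit point mass
  represents it.\<close>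

lemma laplace_representation_single: "\<exists>M. laplace_representation \<beta> {v} {} M"
proof -
  let ?M = "return (PiM UNIV (\<lambda>_. borel)) (\<lambda>_. 0) :: ('a set \<Rightarrow> real) measure"
  have [simp]: "spanning_trees {v} {} = {{}}"
    by (subst spanning_trees_eq) (auto simp: simple_graph_def)
  have "euclidean_triangles {} t" for t :: "'a set \<Rightarrow> real"
    by (auto simp: euclidean_triangles_def sqdist_def heron_def)
  moreover have "(\<lambda>t. t e) \<in> borel_measurable ?M" for e
    unfolding measurable_return1 by (rule measurable_component_singleton) simp
  moreover have "emeasure ?M UNIV = 1"
    using prob_space.emeasure_space_1[OF prob_space_return[of "\<lambda>_. 0" "PiM UNIV (\<lambda>_. borel) :: ('a set \<Rightarrow> real) measure"]]
    by (simp add: space_PiM)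
  ultimately have "laplace_representation \<beta> {v} {} ?M"
    by (auto simp: laplace_representation_def spanning_tree_poly_def space_PiM)
  then show ?thesis by blast
qed

lemma measurable_cone:
  assumes M [measurable]: "\<And>e. (\<lambda>t. t e) \<in> borel_measurable M"
  shows "(\<lambda>(t, q). cone_lengths n a b c t q e) \<in> borel_measurable (M \<Otimes>\<^sub>M radial_measure \<beta>)"
proof -
  have [measurable]: "(\<lambda>p. fst p e) \<in> borel_measurable (M \<Otimes>\<^sub>M radial_measure \<beta>)" for e
    by measurable
  have s [measurable]: "(\<lambda>p. sqdist (fst p) i j) \<in> borel_measurable (M \<Otimes>\<^sub>M radial_measure \<beta>)" for i j
    unfolding sqdist_def by (cases "i = j") auto
  have [measurable]: "(\<lambda>p. fst (vertex (fst p) a b c k)) \<in> borel_measurable (M \<Otimes>\<^sub>M radial_measure \<beta>)" for k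
    unfolding vertex_def vertex_c_def Let_def
    by (cases "k = a"; cases "k = b") auto
  have [measurable]: "(\<lambda>p. snd (vertex (fst p) a b c k)) \<in> borel_measurable (M \<Otimes>\<^sub>M radial_measure \<beta>)" for k
    unfolding vertex_def vertex_c_def Let_def
    by (cases "k = a"; cases "k = b") auto
  have q [measurable]: "(\<lambda>q. fst q) \<in> borel_measurable (radial_measure \<beta>)"
    "(\<lambda>q. fst (snd q)) \<in> borel_measurable (radial_measure \<beta>)"
    "(\<lambda>q. snd (snd q)) \<in> borel_measurable (radial_measure \<beta>)"
    by (auto simp: measurable_cong_sets[OF sets_radial_measure refl]
        intro!: borel_measurable_continuous_onI continuous_intros)
  have [measurable]: "(\<lambda>p. fst (snd p)) \<in> borel_measurable (M \<Otimes>\<^sub>M radial_measure \<beta>)"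
    "(\<lambda>p. fst (snd (snd p))) \<in> borel_measurable (M \<Otimes>\<^sub>M radial_measure \<beta>)"
    "(\<lambda>p. snd (snd (snd p))) \<in> borel_measurable (M \<Otimes>\<^sub>M radial_measure \<beta>)"
    using measurable_compose[OF measurable_snd q(1)] measurable_compose[OF measurable_snd q(2)]
      measurable_compose[OF measurable_snd q(3)] by auto
  show ?thesis
    unfolding cone_lengths_def case_prod_beta Let_def by (cases "n \<in> e") auto
qed

text \<open>The new measure is the image of \<open>M\<close> times the radial measure under the cone
  map. For fixed old lengths, the inner integral over the new vertex gives
  \<open>s powr (- \<beta>)\<close> and replaces \<open>w\<close> by the meshed weights
  \<open>w'\<close>, at which the old representation applies.\<close>

lemma laplace_representation_stack:
  assumes rep: "laplace_representation \<beta> V E M" and \<beta>: "1 < \<beta>"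
    and G: "simple_graph V E" and n: "n \<notin> V" and V: "{a, b, c} \<subseteq> V"
    and abc: "a \<noteq> b \<longrightarrow> {a, b} \<in> E" "b \<noteq> c \<longrightarrow> {b, c} \<in> E" "a \<noteq> c \<longrightarrow> {a, c} \<in> E"
  shows "\<exists>M. laplace_representation \<beta> (insert n V) (E \<union> {{n, a}, {n, b}, {n, c}}) M"
proof -
  let ?E = "E \<union> {{n, a}, {n, b}, {n, c}}"
  let ?P = "PiM UNIV (\<lambda>_. borel) :: ('a set \<Rightarrow> real) measure"
  define R where "R = radial_measure \<beta>"
  \<comment> \<open>Restricting the target makes the triangle condition hold on the whole space of
    \<open>M'\<close>, as the representation demands.\<close>
  define N where "N = restrict_space ?P {t. euclidean_triangles ?E t}"
  define h where "h = (\<lambda>(t, q). cone_lengths n a b c t q)"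
  define M' where "M' = distr (M \<Otimes>\<^sub>M R) N h"
  interpret R: sigma_finite_measure R
    unfolding R_def by (rule sigma_finite_radial_measure)
  have tri: "euclidean_triangles E t" if "t \<in> space M" for t
    using rep that by (simp add: laplace_representation_def)
  have meas [measurable]: "(\<lambda>t. t e) \<in> borel_measurable M" for e
    using rep by (simp add: laplace_representation_def)
  have h: "h \<in> M \<Otimes>\<^sub>M R \<rightarrow>\<^sub>M N"
    unfolding N_def
  proof (rule measurable_restrict_space2)
    show "h \<in> space (M \<Otimes>\<^sub>M R) \<rightarrow> {t. euclidean_triangles ?E t}"
      using euclidean_triangles_cone[OF G tri n V abc] by (auto simp: h_def space_pair_measure)
    show "h \<in> M \<Otimes>\<^sub>M R \<rightarrow>\<^sub>M ?P"
      unfolding h_def case_prod_beta R_def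
      by (rule measurable_PiM_single')
        (use measurable_cone[OF meas] in \<open>auto simp: case_prod_beta\<close>)
  qed
  have comp [measurable]: "(\<lambda>t. t e) \<in> borel_measurable N" for e
    unfolding N_def by (intro measurable_restrict_space1 measurable_component_singleton) auto
  have "(\<integral>\<^sup>+t. ennreal (exp (- (\<Sum>e\<in>?E. w e * t e))) \<partial>M') = ennreal (spanning_tree_poly (insert n V) ?E w powr (- \<beta>))"
    if w: "\<forall>e\<in>?E. 0 \<le> w e" and pos: "0 < spanning_tree_poly (insert n V) ?E w" for w
  proof -
    \<comment> \<open>The zeros for repeated vertices make the sum over the set of star edges a
      three-term sum, in agreement with \<open>sum_star\<close> and
      \<open>star_mesh_tree_poly\<close>.\<close>
    define x y z s where "x = w {n, a}" and "y = (if b = a then 0 else w {n, b})"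
      and "z = (if c = a \<or> c = b then 0 else w {n, c})" and "s = x + y + z"
    have xyz: "0 \<le> x" "0 \<le> y" "0 \<le> z" using w by (auto simp: x_def y_def z_def)
    have "x \<noteq> 0 \<or> y \<noteq> 0 \<or> z \<noteq> 0"
      using star_weight_pos[OF G n _ _ w pos] V by (auto simp: x_def y_def z_def split: if_splits)
    then have s: "0 < s" using xyz unfolding s_def by linarith
    define w' where "w' = (\<lambda>e. w e + (if e = {a, b} then x * y / s else 0) +
      (if e = {b, c} then y * z / s else 0) + (if e = {a, c} then x * z / s else 0))"
    have T: "spanning_tree_poly (insert n V) ?E w = s * spanning_tree_poly V E w'"
      unfolding w'_def
      by (rule star_mesh_tree_poly[OF G n]) (use V abc s in \<open>auto simp: x_def y_def z_def s_def\<close>)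
    have w': "\<forall>e\<in>E. 0 \<le> w' e" using w xyz s by (auto simp: w'_def)
    have pos': "0 < spanning_tree_poly V E w'"
      using pos s unfolding T by (simp add: zero_less_mult_iff)
    have fin: "finite ?E" using simple_graph_finite_edges[OF G] by simp
    have inner: "(\<integral>\<^sup>+q. ennreal (exp (- (\<Sum>e\<in>?E. w e * h (t, q) e))) \<partial>R) =
        ennreal (s powr (- \<beta>)) * ennreal (exp (- (\<Sum>e\<in>E. w' e * t e)))" if t: "t \<in> space M" for t
    proof -
      let ?v = "vertex t a b c"
      let ?d = "\<lambda>k q. (fst q - fst (?v k))\<^sup>2 + (fst (snd q) - snd (?v k))\<^sup>2 + \<bar>snd (snd q)\<bar>"
      have exponent: "(\<Sum>e\<in>?E. w e * h (t, q) e) = (\<Sum>e\<in>E. w e * t e) + (x * ?d a q + y * ?d b q + z * ?d c q)" for q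
      proof -
        have "h (t, q) {n, k} = ?d k q" if "k \<in> V" for k
          using cone_new[of k n a b c t "fst q" "fst (snd q)" "snd (snd q)"] that n by (auto simp: h_def)
        moreover have "(\<Sum>e\<in>E. w e * h (t, q) e) = (\<Sum>e\<in>E. w e * t e)"
        proof (rule sum.cong)
          fix e assume "e \<in> E"
          then have "n \<notin> e" using G n by (auto simp: simple_graph_def)
          then show "w e * h (t, q) e = w e * t e" by (simp add: h_def cone_old)
        qed simp
        ultimately show ?thesis
          unfolding sum_star[OF G n V] using V by (auto simp: x_def y_def z_def)
      qed
      have abc_in: "a \<in> {a, b, c}" "b \<in> {a, b, c}" "c \<in> {a, b, c}" by auto
      note dist = vertex_dist[OF tri[OF t] abc, symmetric]
      have star: "(\<integral>\<^sup>+q. ennreal (exp (- (x * ?d a q + y * ?d b q + z * ?d c q))) \<partial>R) =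
          ennreal (s powr (- \<beta>) *
            exp (- ((x * y * sqdist t a b + y * z * sqdist t b c + x * z * sqdist t a c) / s)))"
        using nn_integral_star[OF s_def s \<beta> dist[OF abc_in(1,2)] dist[OF abc_in(2,3)] dist[OF abc_in(1,3)]]
        unfolding case_prod_beta R_def .
      \<comment> \<open>Pairing the meshed weights with the old lengths adds exactly the exponent
        left by the Gaussian integral.\<close>
      have mesh: "(\<Sum>e\<in>E. w' e * t e) = (\<Sum>e\<in>E. w e * t e) +
          (x * y * sqdist t a b + y * z * sqdist t b c + x * z * sqdist t a c) / s"
        unfolding w'_def distrib_right sum.distrib
        by (simp only: sum_delta_edge[OF G abc(1)] sum_delta_edge[OF G abc(2)] sum_delta_edge[OF G abc(3)])
          (simp add: add_divide_distrib)
      have [measurable]: "(\<lambda>q. ennreal (exp (- (x * ?d a q + y * ?d b q + z * ?d c q)))) \<in> borel_measurable R"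
        by (auto simp: R_def measurable_cong_sets[OF sets_radial_measure refl]
            intro!: measurable_compose[OF _ measurable_ennreal] borel_measurable_continuous_onI continuous_intros)
      have "(\<integral>\<^sup>+q. ennreal (exp (- (\<Sum>e\<in>?E. w e * h (t, q) e))) \<partial>R) =
          (\<integral>\<^sup>+q. ennreal (exp (- (\<Sum>e\<in>E. w e * t e))) * ennreal (exp (- (x * ?d a q + y * ?d b q + z * ?d c q))) \<partial>R)"
        unfolding exponent minus_add_distrib exp_add by (simp add: ennreal_mult)
      also have "\<dots> = ennreal (exp (- (\<Sum>e\<in>E. w e * t e))) * ennreal (s powr (- \<beta>) *
            exp (- ((x * y * sqdist t a b + y * z * sqdist t b c + x * z * sqdist t a c) / s)))"
        unfolding star[symmetric] by (rule nn_integral_cmult) measurable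
      also have "\<dots> = ennreal (s powr (- \<beta>)) * ennreal (exp (- (\<Sum>e\<in>E. w' e * t e)))"
        unfolding mesh minus_add_distrib exp_add by (simp add: mult_ac flip: ennreal_mult)
      finally show ?thesis .
    qed
    have mN: "(\<lambda>t. ennreal (exp (- (\<Sum>e\<in>?E. w e * t e)))) \<in> borel_measurable N"
      using comp by (intro measurable_compose[OF _ measurable_ennreal]) measurable
    have "(\<integral>\<^sup>+t. ennreal (exp (- (\<Sum>e\<in>?E. w e * t e))) \<partial>M') =
        (\<integral>\<^sup>+p. ennreal (exp (- (\<Sum>e\<in>?E. w e * h p e))) \<partial>(M \<Otimes>\<^sub>M R))"
      unfolding M'_def by (rule nn_integral_distr[OF h]) (use mN in simp)
    \<comment> \<open>Tonelli with the new vertex inside, by sigma-finiteness of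
      \<open>R\<close>.\<close>
    also have "\<dots> = (\<integral>\<^sup>+t. (\<integral>\<^sup>+q. ennreal (exp (- (\<Sum>e\<in>?E. w e * h (t, q) e))) \<partial>R) \<partial>M)"
      by (rule R.nn_integral_fst[OF measurable_compose[OF h mN], symmetric])
    also have "\<dots> = (\<integral>\<^sup>+t. ennreal (s powr (- \<beta>)) * ennreal (exp (- (\<Sum>e\<in>E. w' e * t e))) \<partial>M)"
      by (intro nn_integral_cong inner)
    also have "\<dots> = ennreal (s powr (- \<beta>)) * (\<integral>\<^sup>+t. ennreal (exp (- (\<Sum>e\<in>E. w' e * t e))) \<partial>M)"
      by (rule nn_integral_cmult) measurable
    also have "\<dots> = ennreal (s powr (- \<beta>)) * ennreal (spanning_tree_poly V E w' powr (- \<beta>))"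
      using rep w' pos' by (simp add: laplace_representation_def)
    also have "\<dots> = ennreal (spanning_tree_poly (insert n V) ?E w powr (- \<beta>))"
      unfolding T using s pos' by (simp add: powr_mult flip: ennreal_mult)
    finally show ?thesis .
  qed
  moreover have "space M' \<subseteq> {t. euclidean_triangles ?E t}"
    by (auto simp: M'_def N_def space_restrict_space)
  moreover have "(\<lambda>t. t e) \<in> borel_measurable M'" for e
    unfolding M'_def by simp
  ultimately have "laplace_representation \<beta> (insert n V) ?E M'"
    unfolding laplace_representation_def by auto
  then show ?thesis by blast
qed

lemma stacked_laplace_representation:
  assumes "stacked V E" "1 < \<beta>"
  shows "\<exists>M. laplace_representation \<beta> V E M"
  using assms(1)
proof (induction rule: stacked.induct)
  case (single v)
  show ?case by (rule laplace_representation_single)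
next
  case (stack V E n a b c)
  then obtain M where M: "laplace_representation \<beta> V E M" by blast
  show ?case
    by (rule laplace_representation_stack[OF M assms(2) stacked_simple[OF stack.hyps(1)] stack.hyps(2-6)])
qed

section \<open>Passing to connected spanning subgraphs\<close>

lemma spanning_tree_poly_subgraph:
  assumes G: "simple_graph V H" "E \<subseteq> H" and w: "\<And>e. e \<in> E \<Longrightarrow> w e = x e" "\<And>e. e \<in> H - E \<Longrightarrow> w e = 0"
  shows "spanning_tree_poly V H w = spanning_tree_poly V E x"
proof -
  have fin: "finite H" using simple_graph_finite_edges[OF G(1)] .
  have "spanning_tree_poly V H w = (\<Sum>T\<in>spanning_trees V E. \<Prod>e\<in>T. w e)"
    unfolding spanning_tree_poly_def
  proof (rule sum.mono_neutral_right)
    show "finite (spanning_trees V H)"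
      by (rule finite_subset[of _ "Pow H"]) (use fin in \<open>auto simp: spanning_trees_def\<close>)
    show "spanning_trees V E \<subseteq> spanning_trees V H"
      using G(2) by (auto simp: spanning_trees_def)
    show "\<forall>T\<in>spanning_trees V H - spanning_trees V E. (\<Prod>e\<in>T. w e) = 0"
    proof
      fix T assume T: "T \<in> spanning_trees V H - spanning_trees V E"
      then obtain e where e: "e \<in> T" "e \<notin> E" "T \<subseteq> H" by (auto simp: spanning_trees_def)
      then have "w e = 0" "finite T" using w(2) fin finite_subset by auto
      then show "(\<Prod>e\<in>T. w e) = 0" using e(1) prod_zero by metis
    qed
  qed
  also have "\<dots> = spanning_tree_poly V E x"
    unfolding spanning_tree_poly_def
    by (intro sum.cong prod.cong) (use w(1) in \<open>auto simp: spanning_trees_def\<close>)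
  finally show ?thesis .
qed

lemma spanning_tree_poly_pos:
  assumes "simple_graph V E" "connected_graph V E" "\<forall>e\<in>E. 0 < x e"
  shows "0 < spanning_tree_poly V E x"
  unfolding spanning_tree_poly_def
proof (rule sum_pos)
  show "finite (spanning_trees V E)"
    by (rule finite_subset[of _ "Pow E"])
      (use simple_graph_finite_edges[OF assms(1)] in \<open>auto simp: spanning_trees_def\<close>)
  show "spanning_trees V E \<noteq> {}" by (rule spanning_trees_nonempty[OF assms(1,2)])
  show "0 < (\<Prod>e\<in>T. x e)" if "T \<in> spanning_trees V E" for T
    using that assms(3) by (intro prod_pos) (auto simp: spanning_trees_def)
qed

text \<open>Weight 0 on \<open>H - E\<close> removes those edges from the polynomial and those
  coordinates from the exponential, so the measure of \<open>H\<close> also serves \<open>E\<close>.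
  Connectedness of \<open>E\<close> makes the polynomial positive.\<close>

lemma completely_monotone_substacked:
  assumes H: "stacked V H" "E \<subseteq> H" and con: "connected_graph V E" and \<beta>: "1 < \<beta>"
  shows "completely_monotone E (\<lambda>x. spanning_tree_poly V E x powr (- \<beta>))"
proof -
  obtain M where M: "laplace_representation \<beta> V H M"
    using stacked_laplace_representation[OF H(1) \<beta>] by blast
  have sH: "simple_graph V H" by (rule stacked_simple[OF H(1)])
  then have sE: "simple_graph V E" using H(2) by (auto simp: simple_graph_def)
  have fin: "finite H" by (rule simple_graph_finite_edges[OF sH])
  have meas: "(\<lambda>t. t e) \<in> borel_measurable M" for e
    using M by (simp add: laplace_representation_def)
  have nonneg: "0 \<le> t e" if "t \<in> space M" "e \<in> E" for t e
    using M that H(2) by (auto simp: laplace_representation_def euclidean_triangles_def)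
  have nn: "(\<integral>\<^sup>+t. ennreal (exp (- (\<Sum>e\<in>E. x e * t e))) \<partial>M) = ennreal (spanning_tree_poly V E x powr (- \<beta>))"
    if x: "\<forall>e\<in>E. 0 < x e" for x
  proof -
    define w where "w = (\<lambda>e. if e \<in> E then x e else 0)"
    have T: "spanning_tree_poly V H w = spanning_tree_poly V E x"
      by (rule spanning_tree_poly_subgraph[OF sH H(2)]) (auto simp: w_def)
    have "(\<Sum>e\<in>H. w e * t e) = (\<Sum>e\<in>E. x e * t e)" for t
      using fin H(2) by (intro sum.mono_neutral_cong_right) (auto simp: w_def)
    moreover have "(\<integral>\<^sup>+t. ennreal (exp (- (\<Sum>e\<in>H. w e * t e))) \<partial>M) = ennreal (spanning_tree_poly V H w powr (- \<beta>))"
      using M spanning_tree_poly_pos[OF sE con x] x unfolding laplace_representation_def T[symmetric]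
      by (auto simp: w_def less_imp_le)
    ultimately show ?thesis by (simp add: T)
  qed
  have meas_exp: "(\<lambda>t. exp (- (\<Sum>e\<in>E. x e * t e))) \<in> borel_measurable M" for x
    using meas by measurable
  have int: "integrable M (\<lambda>t. exp (- (\<Sum>e\<in>E. x e * t e)))" if "\<forall>e\<in>E. 0 < x e" for x
    by (rule integrableI_nonneg) (use meas_exp nn[OF that] in auto)
  have "spanning_tree_poly V E x powr (- \<beta>) = (\<integral>t. exp (- (\<Sum>e\<in>E. x e * t e)) \<partial>M)"
    if "x \<in> pos_orthant E" for x
  proof -
    have "\<forall>e\<in>E. 0 < x e" using that by (auto simp: pos_orthant_def)
    from nn[OF this] show ?thesis
      by (simp add: integral_eq_nn_integral[OF meas_exp])
  qed
  with finite_subset[OF H(2) fin] meas nonneg int show ?thesis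
    by (rule completely_monotone_laplace)
qed

section \<open>Graphs of treewidth at most 3\<close>

definition clique :: "'v set set \<Rightarrow> 'v set \<Rightarrow> bool" where
  "clique E C \<longleftrightarrow> (\<forall>p\<in>C. \<forall>q\<in>C. p \<noteq> q \<longrightarrow> {p, q} \<in> E)"

lemma clique_mono: "clique E C \<Longrightarrow> E \<subseteq> E' \<Longrightarrow> C' \<subseteq> C \<Longrightarrow> clique E' C'"
  by (auto simp: clique_def)

lemma card_le_3_obtain:
  assumes "finite C" "C \<noteq> {}" "card C \<le> 3"
  obtains a b c where "C = {a, b, c}"
proof -
  have "card C = 1 \<or> card C = 2 \<or> card C = 3"
    using assms by (cases "card C") auto
  then show ?thesis
  proof (elim disjE)
    assume "card C = 1"
    then obtain a where "C = {a}" by (rule card_1_singletonE)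
    then show ?thesis using that[of a a a] by simp
  next
    assume "card C = 2"
    then obtain a b where "C = {a, b}" by (auto simp: card_2_iff)
    then show ?thesis using that[of a b b] by simp
  next
    assume "card C = 3"
    then obtain a b c where "C = {a, b, c}" by (auto simp: card_3_iff)
    then show ?thesis using that by blast
  qed
qed

lemma stacked_add_vertex:
  assumes st: "stacked V E" and n: "n \<notin> V" and C: "C \<subseteq> V" "clique E C" "finite C" "card C \<le> 3"
  shows "\<exists>E'. stacked (insert n V) E' \<and> E \<subseteq> E' \<and> clique E' (insert n C)"
proof (cases "C = {}")
  case True
  \<comment> \<open>With no prescribed neighbour, \<open>n\<close> is attached to an arbitrary
    vertex; only a supergraph is sought.\<close>
  obtain v where "v \<in> V" using st by (cases rule: stacked.cases) auto
  then have "stacked (insert n V) (E \<union> {{n, v}, {n, v}, {n, v}})"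
    using stacked.stack[OF st n, of v v v] by simp
  then show ?thesis using True by (intro exI[of _ "E \<union> {{n, v}, {n, v}, {n, v}}"]) (auto simp: clique_def)
next
  case False
  then obtain a b c where abc: "C = {a, b, c}"
    using card_le_3_obtain C(3,4) by metis
  have K: "a \<noteq> b \<longrightarrow> {a, b} \<in> E" "b \<noteq> c \<longrightarrow> {b, c} \<in> E" "a \<noteq> c \<longrightarrow> {a, c} \<in> E"
    using C(2) by (auto simp: clique_def abc)
  have "stacked (insert n V) (E \<union> {{n, a}, {n, b}, {n, c}})"
    by (rule stacked.stack[OF st n _ K]) (use C(1) abc in simp)
  moreover have "clique (E \<union> {{n, a}, {n, b}, {n, c}}) (insert n C)"
    unfolding clique_def
  proof (intro ballI impI)
    fix p q assume pq: "p \<in> insert n C" "q \<in> insert n C" "p \<noteq> q"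
    show "{p, q} \<in> E \<union> {{n, a}, {n, b}, {n, c}}"
    proof (cases "p = n \<or> q = n")
      case True
      then show ?thesis using pq by (auto simp: abc insert_commute)
    next
      case False
      then show ?thesis using pq C(2) by (auto simp: clique_def)
    qed
  qed
  ultimately show ?thesis by blast
qed

text \<open>Bags may be empty and the construction starts from no vertices at all, whereas
  \<open>stacked\<close> requires one.\<close>

definition stacked_or_empty :: "'v set \<Rightarrow> 'v set set \<Rightarrow> bool" where
  "stacked_or_empty V E \<longleftrightarrow> stacked V E \<or> V = {} \<and> E = {}"

text \<open>The missing vertices of a bag enter one at a time. A bag has at most four vertices, so
  each newcomer joins a clique of at most three.\<close>

lemma stacked_add_clique:
  assumes "finite N" "N \<inter> V = {}" "C \<subseteq> V" "finite C" "clique E C" "card (C \<union> N) \<le> 4" "stacked_or_empty V E"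
  shows "\<exists>E'. stacked_or_empty (V \<union> N) E' \<and> E \<subseteq> E' \<and> clique E' (C \<union> N)"
  using assms(1,2,6)
proof (induction N rule: finite_induct)
  case empty
  then show ?case using assms by auto
next
  case (insert n N)
  have n: "n \<notin> C \<union> N" "n \<notin> V \<union> N" using insert assms(3) by auto
  have fin: "finite (C \<union> N)" using insert assms(4) by simp
  have card: "card (C \<union> N) \<le> 3"
    using insert.prems(2) n fin by simp
  then obtain E1 where E1: "stacked_or_empty (V \<union> N) E1" "E \<subseteq> E1" "clique E1 (C \<union> N)"
    using insert.IH insert.prems by auto
  show ?case
  proof (cases "V \<union> N = {}")
    case True
    then have "E1 = {}" using E1(1) n by (auto simp: stacked_or_empty_def elim: stacked.cases)
    then show ?thesis
      using True E1 assms(3) stacked.single[of n]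
      by (intro exI[of _ "{}"]) (auto simp: stacked_or_empty_def clique_def)
  next
    case False
    then have "stacked (V \<union> N) E1" using E1(1) by (auto simp: stacked_or_empty_def)
    from stacked_add_vertex[OF this n(2) _ E1(3) fin card] assms(3)
    obtain E' where "stacked (insert n (V \<union> N)) E'" "E1 \<subseteq> E'" "clique E' (insert n (C \<union> N))"
      by blast
    then show ?thesis using E1(2) by (intro exI[of _ E']) (auto simp: stacked_or_empty_def)
  qed
qed

text \<open>A subtree of the decomposition tree grows by one adjacent node at a time. The new bag
  meets the vertices treated so far only inside the bag of its neighbour \<open>p\<close>, hence in
  a clique, and its remaining vertices are stacked onto that clique. In the end every bag is a
  clique, so all edges of \<open>E\<close> are present.\<close>

lemma stacked_if_tree_decomposition:
  assumes dec: "tree_decomposition V E I F B" and card: "\<forall>i\<in>I. card (B i) \<le> 4"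
    and G: "simple_graph V E" "V \<noteq> {}"
  shows "\<exists>H. stacked V H \<and> E \<subseteq> H"
proof -
  have tree: "tree_graph I F" and V: "(\<Union>i\<in>I. B i) = V" and bag: "\<forall>e\<in>E. \<exists>i\<in>I. e \<subseteq> B i"
    and sub: "\<And>v. v \<in> V \<Longrightarrow> connected_graph {i\<in>I. v \<in> B i} {f\<in>F. f \<subseteq> {i\<in>I. v \<in> B i}}"
    using dec by (auto simp: tree_decomposition_def)
  have I: "finite I" "I \<noteq> {}" and FI: "\<And>f. f \<in> F \<Longrightarrow> f \<subseteq> I"
    using tree by (auto simp: tree_graph_def simple_graph_def connected_graph_def)
  have conI: "reachable F i j" if "i \<in> I" "j \<in> I" for i j
    using tree that by (auto simp: tree_graph_def connected_graph_def reachable_def)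
  have "forest F"
    using tree forest_iff_no_cycle[of F] by (auto simp: tree_graph_def simple_graph_def)
  then have bridge: "\<not> reachable (F - {{u, v}}) u v" if "{u, v} \<in> F" for u v
    using that by (auto simp: forest_def)
  have finB: "finite (B i)" if "i \<in> I" for i
    using that V G(1) by (auto simp: simple_graph_def intro: finite_subset)
  \<comment> \<open>Connectedness of \<open>S\<close> within \<open>F\<close> is part of the
    invariant because the bridge argument below needs a walk from \<open>k\<close> to
    \<open>p\<close> that avoids the new edge.\<close>
  define good where "good S \<longleftrightarrow> S \<subseteq> I \<and> S \<noteq> {} \<and> (\<forall>i\<in>S. \<forall>j\<in>S. reachable {f\<in>F. f \<subseteq> S} i j) \<and>
    (\<exists>H. stacked_or_empty (\<Union>i\<in>S. B i) H \<and> (\<forall>i\<in>S. clique H (B i)))" for S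
  have extend: "\<exists>i. i \<notin> S \<and> good (insert i S)" if S: "good S" "S \<noteq> I" for S
  proof -
    have SI: "S \<subseteq> I" and Sne: "S \<noteq> {}" and conS: "\<And>i j. i \<in> S \<Longrightarrow> j \<in> S \<Longrightarrow> reachable {f\<in>F. f \<subseteq> S} i j"
      using S(1) unfolding good_def by blast+
    obtain H where H: "stacked_or_empty (\<Union>i\<in>S. B i) H" "\<And>i. i \<in> S \<Longrightarrow> clique H (B i)"
      using S(1) unfolding good_def by blast
    obtain i0 j where ij: "i0 \<in> S" "j \<in> I" "j \<notin> S" using SI Sne S(2) by blast
    have "reachable F i0 j" using conI ij SI by blast
    \<comment> \<open>A walk starting in \<open>S\<close> either stays there or has an edge leaving
      \<open>S\<close>; such an edge supplies the neighbour \<open>p\<close> and the new node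
      \<open>i\<close>.\<close>
    then have "j \<in> S \<or> (\<exists>p i. p \<in> S \<and> i \<notin> S \<and> {p, i} \<in> F)"
      by (induction rule: reachable_induct) (use ij in auto)
    then obtain p i where pi: "p \<in> S" "i \<notin> S" "{p, i} \<in> F" using ij by blast
    have i: "i \<in> I" using FI[OF pi(3)] by auto
    \<comment> \<open>The edge \<open>{p, i}\<close> is a bridge, so the subtree of bags containing \<open>v\<close>, which joins \<open>i\<close> to
      \<open>k \<in> S\<close>, must use it.\<close>
    have "v \<in> B p" if v: "v \<in> B i" "v \<in> B k" "k \<in> S" for v k
    proof (rule ccontr)
      assume vp: "v \<notin> B p"
      let ?Fv = "{f\<in>F. f \<subseteq> {i\<in>I. v \<in> B i}}"
      have "v \<in> V" using v i V by auto
      then have "reachable ?Fv i k"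
        using sub[of v] v i SI by (auto simp: connected_graph_def reachable_def)
      moreover have "?Fv \<subseteq> F - {{p, i}}" using vp by auto
      ultimately have ik: "reachable (F - {{p, i}}) i k" by (rule reachable_mono[rotated])
      have "{f\<in>F. f \<subseteq> S} \<subseteq> F - {{p, i}}" using pi by auto
      then have "reachable (F - {{p, i}}) k p" by (rule reachable_mono) (rule conS[OF v(3) pi(1)])
      with ik have "reachable (F - {{p, i}}) p i" using reachable_sym reachable_trans by fast
      then show False using bridge[OF pi(3)] by simp
    qed
    then have Bp: "B i \<inter> (\<Union>i\<in>S. B i) \<subseteq> B p" by blast
    let ?U = "\<Union>i\<in>S. B i"
    have "\<exists>H'. stacked_or_empty (?U \<union> (B i - ?U)) H' \<and> H \<subseteq> H' \<and> clique H' (B i \<inter> ?U \<union> (B i - ?U))"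
    proof (rule stacked_add_clique)
      show "clique H (B i \<inter> ?U)" by (rule clique_mono[OF H(2)[OF pi(1)] order_refl Bp])
      have "B i \<inter> ?U \<union> (B i - ?U) = B i" by blast
      then show "card (B i \<inter> ?U \<union> (B i - ?U)) \<le> 4" using card i by simp
    qed (use finB[OF i] H(1) in auto)
    moreover have "?U \<union> (B i - ?U) = (\<Union>i\<in>insert i S. B i)" "B i \<inter> ?U \<union> (B i - ?U) = B i" by auto
    ultimately obtain H' where H': "stacked_or_empty (\<Union>i\<in>insert i S. B i) H'" "H \<subseteq> H'" "clique H' (B i)"
      by auto
    have "reachable {f\<in>F. f \<subseteq> insert i S} x y" if "x \<in> insert i S" "y \<in> insert i S" for x y
    proof -
      have "{p, i} \<in> {f\<in>F. f \<subseteq> insert i S}" using pi by auto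
      then have ip: "reachable {f\<in>F. f \<subseteq> insert i S} p i" by (rule reachable_edge)
      have "reachable {f\<in>F. f \<subseteq> insert i S} p z" if "z \<in> insert i S" for z
      proof (cases "z = i")
        case False
        then have "z \<in> S" using that by simp
        then show ?thesis by (intro reachable_mono[OF _ conS[OF pi(1)]]) auto
      qed (use ip in simp)
      then show ?thesis using that reachable_sym reachable_trans by fast
    qed
    moreover have "clique H' (B k)" if "k \<in> insert i S" for k
      using that H'(3) clique_mono[OF H(2) H'(2) order_refl] by auto
    ultimately have "good (insert i S)"
      unfolding good_def using H'(1) SI i by blast
    then show ?thesis using pi(2) by blast
  qed
  obtain i0 where i0: "i0 \<in> I" using I by blast
  have "good {i0}"
  proof -
    have "\<exists>H. stacked_or_empty ({} \<union> B i0) H \<and> {} \<subseteq> H \<and> clique H ({} \<union> B i0)"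
      by (rule stacked_add_clique) (use finB[OF i0] card i0 in \<open>auto simp: clique_def stacked_or_empty_def\<close>)
    then show ?thesis using i0 by (auto simp: good_def)
  qed
  moreover have "\<exists>S. good S \<and> card S = Suc k" if "Suc k \<le> card I" for k
    using that
  proof (induction k)
    case 0
    then show ?case using \<open>good {i0}\<close> by (intro exI[of _ "{i0}"]) simp
  next
    case (Suc k)
    then obtain S where S: "good S" "card S = Suc k" by auto
    then have "S \<noteq> I" using Suc.prems by auto
    then obtain i where i: "i \<notin> S" "good (insert i S)" using extend[OF S(1)] by blast
    have "finite S" using S(1) I(1) finite_subset by (auto simp: good_def)
    then show ?case using i S(2) by (intro exI[of _ "insert i S"]) simp
  qed
  from this[of "card I - 1"] obtain S where "good S" "card S = card I"
    using I card_gt_0_iff[of I] by auto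
  then have "good I" using I(1) card_subset_eq[of I S] by (simp add: good_def)
  then obtain H where H: "stacked_or_empty V H" "\<And>i. i \<in> I \<Longrightarrow> clique H (B i)"
    using V by (auto simp: good_def)
  have "E \<subseteq> H"
  proof
    fix e assume e: "e \<in> E"
    then obtain u v where uv: "e = {u, v}" "u \<noteq> v" using G(1) by (auto simp: simple_graph_def card_2_iff)
    obtain i where "i \<in> I" "e \<subseteq> B i" using bag e by blast
    then show "e \<in> H" using H(2) uv by (auto simp: clique_def)
  qed
  then show ?thesis using H(1) G(2) by (auto simp: stacked_or_empty_def)
qed

text \<open>Ensures that the minimum defining \<open>treewidth\<close> is attained by some
  decomposition.\<close>

lemma tree_decomposition_one_bag:
  assumes "simple_graph V E"
  shows "tree_decomposition V E {0} {} (\<lambda>_. V)"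
proof -
  have "\<not> graph_cycle {} p" for p :: "nat list"
    by (cases p) (auto simp: graph_cycle_def)
  then show ?thesis
    using assms
    by (auto simp: tree_decomposition_def tree_graph_def simple_graph_def connected_graph_def)
qed

lemma stacked_if_treewidth_le_3:
  assumes G: "simple_graph V E" "V \<noteq> {}" and tw: "treewidth V E \<le> 3"
  shows "\<exists>H. stacked V H \<and> E \<subseteq> H"
proof -
  have "\<exists>w I F B. tree_decomposition V E I F B \<and> w = decomposition_width I B"
    using tree_decomposition_one_bag[OF G(1)] by blast
  from LeastI_ex[OF this] obtain I F B where
    dec: "tree_decomposition V E I F B" and w: "treewidth V E = decomposition_width I B"
    unfolding treewidth_def by blast
  have "finite I" using dec by (auto simp: tree_decomposition_def tree_graph_def simple_graph_def)
  have "card (B i) \<le> 4" if "i \<in> I" for i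
  proof -
    have "card (B i) \<le> Max ((\<lambda>i. card (B i)) ` I)"
      using \<open>finite I\<close> that by (intro Max_ge) auto
    \<comment> \<open>The subtraction in the width is truncated, but a width of at most 3 still
      bounds the maximal bag size by 4.\<close>
    then show ?thesis
      using tw w unfolding decomposition_width_def by linarith
  qed
  then show ?thesis using stacked_if_tree_decomposition[OF dec _ G] by blast
qed

lemma completely_monotone_treewidth_le_3:
  assumes "simple_graph V E" "connected_graph V E" "treewidth V E \<le> 3" "1 < \<beta>"
  shows "completely_monotone E (\<lambda>x. spanning_tree_poly V E x powr (- \<beta>))"
proof -
  have "V \<noteq> {}" using assms(2) by (simp add: connected_graph_def)
  then obtain H where "stacked V H" "E \<subseteq> H"
    using stacked_if_treewidth_le_3[OF assms(1) _ assms(3)] by blast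
  then show ?thesis by (rule completely_monotone_substacked[OF _ _ assms(2,4)])
qed

theorem corollary4p8:
  shows "(\<forall>(V :: 'v set) E. simple_graph V E \<and> connected_graph V E \<and> treewidth V E \<le> 3 \<longrightarrow>
            (\<forall>\<beta>::real. \<beta> > 1 \<longrightarrow>
               completely_monotone E (\<lambda>x. spanning_tree_poly V E x powr (- \<beta>))))
       \<and> (\<forall>\<beta>::real. 1 < \<beta> \<and> \<beta> < 3 / 2 \<longrightarrow>
            (\<forall>(V :: 'v set) E. partial_k_tree 3 V E \<and> connected_graph V E \<longrightarrow>
               (V, E) \<in> cm_graph_class \<beta>))"
proof (intro conjI allI impI)
  fix V :: "'v set" and E and \<beta> :: real
  assume "simple_graph V E \<and> connected_graph V E \<and> treewidth V E \<le> 3" "1 < \<beta>"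
  then show "completely_monotone E (\<lambda>x. spanning_tree_poly V E x powr (- \<beta>))"
    by (intro completely_monotone_treewidth_le_3) auto
next
  fix \<beta> :: real and V :: "'v set" and E
  assume "1 < \<beta> \<and> \<beta> < 3 / 2" "partial_k_tree 3 V E \<and> connected_graph V E"
  then show "(V, E) \<in> cm_graph_class \<beta>"
    by (auto simp: cm_graph_class_def partial_k_tree_def intro: completely_monotone_treewidth_le_3)
qed

end
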